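(* Let $p$ be an odd prime number and $k=\mathbb{Z}_p=\mathbb{Z}/p\mathbb{Z}$. Let $V=\mathbb{Z}_p\times\mathbb{Z}_p$ be a two-dimensional vector space over $\mathbb{Z}_p$ with basis $x,y$, and let $\sigma$ be the automorphism of $V$ (of order $p$) given by $\sigma(x)=x$, $\sigma(y)=x+y$. Let $H=\bigoplus_{i=0}^{\infty}V$ be the direct sum of countably infinitely many copies of $V$, let $\sigma$ act on $H$ diagonally (i.e. by $\sigma(x_i)=x_i$, $\sigma(y_i)=x_i+y_i$ for every $i$, where $x_i,y_i$ denote the basis elements $x,y$ of the $i$-th copy of $V$), and let $G=\langle\sigma\rangle\ltimes H$ be the resulting semidirect product, where $\langle\sigma\rangle$ is the cyclic group of order $p$. Then the kernel of the restriction map $\mathrm{res}:H^*(G,k)\rightarrow H^*(H,k)$ is not finitely generated as an ideal of $H^*(G,k)$.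
   Context: $H^*(G,k)=\bigoplus_{n\ge 0}H^n(G,k)$ is the group cohomology ring with trivial coefficients $k$, under the cup product. *)

theory Defs
  imports
    "HOL-Algebra.Product_Groups"
    "HOL-Algebra.Bij"
    "HOL-Algebra.QuotRing"
    "HOL-Number_Theory.Residues"
begin

section \<open>Group cohomology with trivial coefficients\<close>

text \<open>
  \<open>H\<^sup>*(G, K)\<close> for a group \<open>G\<close> acting trivially on a commutative ring \<open>K\<close>, computed from the
  inhomogeneous (bar) cochains: an \<open>n\<close>-cochain is a function \<open>G\<^sup>n \<rightarrow> K\<close>, where \<open>n\<close>-tuples are
  lists of length \<open>n\<close>, and is \<open>undefined\<close> outside \<open>G\<^sup>n\<close>.
\<close>

definition tuples :: "('a, 'm) monoid_scheme \<Rightarrow> nat \<Rightarrow> 'a list set"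
  where "tuples G n = {xs. length xs = n \<and> set xs \<subseteq> carrier G}"

definition cochain_group ::
    "('a, 'm) monoid_scheme \<Rightarrow> ('k, 'r) ring_scheme \<Rightarrow> nat \<Rightarrow> ('a list \<Rightarrow> 'k) monoid"
  where "cochain_group G K n = product_group (tuples G n) (\<lambda>_. add_monoid K)"

text \<open>
  \<open>merge_at G i [g\<^sub>1, \<dots>, g\<^sub>m] = [g\<^sub>1, \<dots>, g\<^sub>i g\<^sub>i\<^sub>+\<^sub>1, \<dots>, g\<^sub>m]\<close> for \<open>1 \<le> i < m\<close>; the list index \<open>!\<close> starts
  at \<open>0\<close>, so \<open>g\<^sub>i\<close> is \<open>xs ! (i - 1)\<close>.
\<close>

definition merge_at :: "('a, 'm) monoid_scheme \<Rightarrow> nat \<Rightarrow> 'a list \<Rightarrow> 'a list"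
  where "merge_at G i xs =
    take (i - 1) xs @ [xs ! (i - 1) \<otimes>\<^bsub>G\<^esub> xs ! i] @ drop (i + 1) xs"

text \<open>
  \<open>(d f)(g\<^sub>1, \<dots>, g\<^sub>n\<^sub>+\<^sub>1) = f(g\<^sub>2, \<dots>, g\<^sub>n\<^sub>+\<^sub>1) + \<Sum>\<^sub>1\<^sub>\<le>\<^sub>i\<^sub>\<le>\<^sub>n (-1)\<^sup>i f(g\<^sub>1, \<dots>, g\<^sub>i g\<^sub>i\<^sub>+\<^sub>1, \<dots>, g\<^sub>n\<^sub>+\<^sub>1)
    + (-1)\<^sup>n\<^sup>+\<^sup>1 f(g\<^sub>1, \<dots>, g\<^sub>n)\<close>
\<close>

definition coboundary_map ::
    "('a, 'm) monoid_scheme \<Rightarrow> ('k, 'r) ring_scheme \<Rightarrow> nat \<Rightarrow> ('a list \<Rightarrow> 'k) \<Rightarrow> 'a list \<Rightarrow> 'k"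
  where "coboundary_map G K n f = (\<lambda>xs \<in> tuples G (Suc n).
    f (tl xs)
    \<oplus>\<^bsub>K\<^esub> (\<Oplus>\<^bsub>K\<^esub>i\<in>{1..n}. (\<ominus>\<^bsub>K\<^esub> \<one>\<^bsub>K\<^esub>) [^]\<^bsub>K\<^esub> i \<otimes>\<^bsub>K\<^esub> f (merge_at G i xs))
    \<oplus>\<^bsub>K\<^esub> (\<ominus>\<^bsub>K\<^esub> \<one>\<^bsub>K\<^esub>) [^]\<^bsub>K\<^esub> Suc n \<otimes>\<^bsub>K\<^esub> f (butlast xs))"

definition cocycle_group ::
    "('a, 'm) monoid_scheme \<Rightarrow> ('k, 'r) ring_scheme \<Rightarrow> nat \<Rightarrow> ('a list \<Rightarrow> 'k) monoid"
  where "cocycle_group G K n = (cochain_group G K n)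
    \<lparr>carrier := kernel (cochain_group G K n) (cochain_group G K (Suc n)) (coboundary_map G K n)\<rparr>"

definition coboundaries ::
    "('a, 'm) monoid_scheme \<Rightarrow> ('k, 'r) ring_scheme \<Rightarrow> nat \<Rightarrow> ('a list \<Rightarrow> 'k) set"
  where "coboundaries G K n = (case n of
      0 \<Rightarrow> {\<one>\<^bsub>cochain_group G K 0\<^esub>}
    | Suc m \<Rightarrow> coboundary_map G K m ` carrier (cochain_group G K m))"

definition cohomology_group ::
    "('a, 'm) monoid_scheme \<Rightarrow> ('k, 'r) ring_scheme \<Rightarrow> nat \<Rightarrow> ('a list \<Rightarrow> 'k) set monoid"
  where "cohomology_group G K n = cocycle_group G K n Mod coboundaries G K n"

definition cohomology_class ::
    "('a, 'm) monoid_scheme \<Rightarrow> ('k, 'r) ring_scheme \<Rightarrow> nat \<Rightarrow> ('a list \<Rightarrow> 'k) \<Rightarrow> ('a list \<Rightarrow> 'k) set"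
  where "cohomology_class G K n f = coboundaries G K n #>\<^bsub>cocycle_group G K n\<^esub> f"

definition cup_cochain ::
    "('a, 'm) monoid_scheme \<Rightarrow> ('k, 'r) ring_scheme \<Rightarrow> nat \<Rightarrow> nat \<Rightarrow>
      ('a list \<Rightarrow> 'k) \<Rightarrow> ('a list \<Rightarrow> 'k) \<Rightarrow> 'a list \<Rightarrow> 'k"
  where "cup_cochain G K m n f g =
    (\<lambda>xs \<in> tuples G (m + n). f (take m xs) \<otimes>\<^bsub>K\<^esub> g (drop m xs))"

text \<open>
  Operations on classes are written as unions over all representatives, in the same way as
  \<^const>\<open>rcoset_mult\<close>; on cohomology classes the sets in the union all coincide.
\<close>

definition cup_class ::
    "('a, 'm) monoid_scheme \<Rightarrow> ('k, 'r) ring_scheme \<Rightarrow> nat \<Rightarrow> nat \<Rightarrow>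
      ('a list \<Rightarrow> 'k) set \<Rightarrow> ('a list \<Rightarrow> 'k) set \<Rightarrow> ('a list \<Rightarrow> 'k) set"
  where "cup_class G K m n A B =
    (\<Union>f\<in>A. \<Union>g\<in>B. cohomology_class G K (m + n) (cup_cochain G K m n f g))"

text \<open>
  The underlying additive group is the direct sum of the \<open>H\<^sup>n(G, K)\<close>. The groups \<open>H\<^sup>n(G, K)\<close> are
  written multiplicatively, so the \<open>n\<close>-th component \<open>\<Sum>\<^sub>i\<^sub>\<le>\<^sub>n a\<^sub>i \<union> b\<^sub>n\<^sub>-\<^sub>i\<close> of a product is a
  \<^const>\<open>finprod\<close>.
\<close>

definition cohomology_ring ::
    "('a, 'm) monoid_scheme \<Rightarrow> ('k, 'r) ring_scheme \<Rightarrow> (nat \<Rightarrow> ('a list \<Rightarrow> 'k) set) ring"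
  where "cohomology_ring G K =
    \<lparr>carrier = carrier (sum_group UNIV (cohomology_group G K)),
     monoid.mult = (\<lambda>a b n. \<Otimes>\<^bsub>cohomology_group G K n\<^esub>i\<in>{..n}. cup_class G K i (n - i) (a i) (b (n - i))),
     one = (\<lambda>n. if n = 0 then cohomology_class G K 0 (\<lambda>xs \<in> tuples G 0. \<one>\<^bsub>K\<^esub>)
                else \<one>\<^bsub>cohomology_group G K n\<^esub>),
     zero = \<one>\<^bsub>sum_group UNIV (cohomology_group G K)\<^esub>,
     add = monoid.mult (sum_group UNIV (cohomology_group G K))\<rparr>"

text \<open>
  The map \<open>H\<^sup>*(G, K) \<rightarrow> H\<^sup>*(H, K)\<close> induced by a homomorphism \<open>\<phi> : H \<rightarrow> G\<close>; it is the restriction map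
  when \<open>\<phi>\<close> is the inclusion of a subgroup.
\<close>

definition cohomology_map ::
    "('b, 'n) monoid_scheme \<Rightarrow> ('a, 'm) monoid_scheme \<Rightarrow> ('k, 'r) ring_scheme \<Rightarrow> ('b \<Rightarrow> 'a) \<Rightarrow>
      (nat \<Rightarrow> ('a list \<Rightarrow> 'k) set) \<Rightarrow> nat \<Rightarrow> ('b list \<Rightarrow> 'k) set"
  where "cohomology_map H G K \<phi> = (\<lambda>a \<in> carrier (cohomology_ring G K). \<lambda>n.
    \<Union>f\<in>a n. cohomology_class H K n (\<lambda>xs \<in> tuples H n. f (map \<phi> xs)))"

text \<open>
  \<open>Idl\<close> is the two-sided ideal. Cohomology rings are graded-commutative, so for homogeneous ideals
  left, right and two-sided finite generation agree.
\<close>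

definition finitely_generated_ideal :: "('a, 'm) ring_scheme \<Rightarrow> 'a set \<Rightarrow> bool"
  where "finitely_generated_ideal R I \<longleftrightarrow> (\<exists>S \<subseteq> carrier R. finite S \<and> I = Idl\<^bsub>R\<^esub> S)"

section \<open>The groups \<open>H\<close> and \<open>G = \<langle>\<sigma>\<rangle> \<ltimes> H\<close>\<close>

definition semidirect_product ::
    "('q, 'm) monoid_scheme \<Rightarrow> ('h, 'n) monoid_scheme \<Rightarrow> ('q \<Rightarrow> 'h \<Rightarrow> 'h) \<Rightarrow> ('q \<times> 'h) monoid"
  where "semidirect_product Q H \<alpha> =
    \<lparr>carrier = carrier Q \<times> carrier H,
     monoid.mult = (\<lambda>(q, h) (r, k). (q \<otimes>\<^bsub>Q\<^esub> r, h \<otimes>\<^bsub>H\<^esub> \<alpha> q k)),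
     one = (\<one>\<^bsub>Q\<^esub>, \<one>\<^bsub>H\<^esub>)\<rparr>"

text \<open>The pair \<open>(a, b)\<close> stands for \<open>a x + b y\<close>.\<close>

definition V_group :: "nat \<Rightarrow> (int \<times> int) monoid"
  where "V_group p = add_monoid (residue_ring (int p)) \<times>\<times> add_monoid (residue_ring (int p))"

definition sigma_V :: "nat \<Rightarrow> int \<times> int \<Rightarrow> int \<times> int"
  where "sigma_V p = (\<lambda>(a, b). (a \<oplus>\<^bsub>residue_ring (int p)\<^esub> b, b))"

definition H_group :: "nat \<Rightarrow> (nat \<Rightarrow> int \<times> int) monoid"
  where "H_group p = sum_group UNIV (\<lambda>_. V_group p)"

text \<open>Elements of \<^const>\<open>AutoGroup\<close> are extensional functions, hence the restriction to \<open>H\<close>.\<close>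

definition sigma_H :: "nat \<Rightarrow> (nat \<Rightarrow> int \<times> int) \<Rightarrow> (nat \<Rightarrow> int \<times> int)"
  where "sigma_H p = (\<lambda>h \<in> carrier (H_group p). \<lambda>i. sigma_V p (h i))"

definition sigma_group :: "nat \<Rightarrow> ((nat \<Rightarrow> int \<times> int) \<Rightarrow> (nat \<Rightarrow> int \<times> int)) monoid"
  where "sigma_group p = subgroup_generated (AutoGroup (H_group p)) {sigma_H p}"

definition G_group ::
    "nat \<Rightarrow> (((nat \<Rightarrow> int \<times> int) \<Rightarrow> (nat \<Rightarrow> int \<times> int)) \<times> (nat \<Rightarrow> int \<times> int)) monoid"
  where "G_group p = semidirect_product (sigma_group p) (H_group p) (\<lambda>s h. s h)"

definition H_inclusion ::
    "nat \<Rightarrow> (nat \<Rightarrow> int \<times> int) \<Rightarrow> ((nat \<Rightarrow> int \<times> int) \<Rightarrow> (nat \<Rightarrow> int \<times> int)) \<times> (nat \<Rightarrow> int \<times> int)"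
  where "H_inclusion p h = (\<one>\<^bsub>sigma_group p\<^esub>, h)"

end

theory Submission
  imports Defs
begin

text \<open>
  The kernel \<open>I\<close> of restriction is a graded ideal with \<open>I\<^sup>0 = 0\<close>. If it were finitely generated, then \<open>I\<^sup>2\<close>
  modulo the products of \<open>H\<^sup>1\<close> and \<open>I\<^sup>1\<close> would be a finite-dimensional vector space. It is not: in the spectral
  sequence of the extension, each copy of \<open>V\<close> contributes to \<open>E\<^sup>1\<^sup>,\<^sup>1\<close> the class of the coordinate
  function \<open>x\<^sub>i\<^sup>*\<close> in \<open>H\<^sup>1(\<langle>\<sigma>\<rangle>, H\<^sup>1(H))\<close>, and no finite
  nontrivial combination of these classes is a sum of products.

  The proof makes this visible without the spectral sequence. In \<open>G\<close> the elements \<open>\<sigma>\<close> and \<open>x\<^sub>i\<close> commute,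
  so a class \<open>f\<close> in \<open>H\<^sup>2(G)\<close> has a well-defined value \<open>f(\<sigma>, x\<^sub>i) - f(x\<^sub>i, \<sigma>)\<close>, the commutator of lifts of \<open>\<sigma>\<close> and
  \<open>x\<^sub>i\<close> to the central extension given by \<open>f\<close>. Because \<open>x\<^sub>i\<close> is itself the commutator of \<open>\<sigma>\<close> and \<open>y\<^sub>i\<close>, every
  homomorphism \<open>G \<rightarrow> k\<close> kills it, and so this value is zero on all products of classes of degree \<open>1\<close>
  (\<open>commutator_ring_mult\<close>). Collecting the values for all \<open>i\<close> into a vector, the elements of a finitely
  generated ideal without component in degree \<open>0\<close> have vectors in the span of finitely many, which is a
  finite set (\<open>not_finitely_generated_by_commutators\<close>).

  On the other hand, \<open>I\<close> contains for every \<open>j\<close> the class of an explicit cocycle (\<open>massey\<close>) that is zero on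
  \<open>H\<close> and whose vector has the entry \<open>2\<close> at \<open>j\<close> and \<open>0\<close> elsewhere (\<open>commutator_massey\<close>). For odd \<open>p\<close> these are
  infinitely many different vectors.
\<close>

section \<open>The bar complex of a monoid\<close>

text \<open>
  The bar differential involves only the multiplication of \<open>G\<close>, so the complex is set up over a monoid.
\<close>

locale bar_complex = G: monoid G + K: cring K
  for G :: "('a, 'm) monoid_scheme" and K :: "('k, 'r) ring_scheme"
begin

abbreviation sgn :: "nat \<Rightarrow> 'k"
  where "sgn i \<equiv> (\<ominus>\<^bsub>K\<^esub> \<one>\<^bsub>K\<^esub>) [^]\<^bsub>K\<^esub> i"

text \<open>
  The three kinds of summands in \<^const>\<open>coboundary_map\<close> are the faces \<open>0, \<dots>, n + 1\<close> of a tuple; with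
  one name for all of them the differential is a single alternating sum.
\<close>

definition face :: "nat \<Rightarrow> 'a list \<Rightarrow> 'a list"
  where "face i xs =
    (if i = 0 then tl xs else if i = length xs then butlast xs else merge_at G i xs)"

lemma length_face: "xs \<noteq> [] \<Longrightarrow> i \<le> length xs \<Longrightarrow> length (face i xs) = length xs - 1"
  by (auto simp: face_def merge_at_def)

text \<open>
  Componentwise the end faces follow the same rule as the inner ones, which reduces identities
  between faces to comparing indices.
\<close>

lemma nth_face:
  assumes "i \<le> length xs" "Suc j < length xs"
  shows "face i xs ! j = (if Suc j < i then xs ! j
    else if Suc j = i then xs ! j \<otimes>\<^bsub>G\<^esub> xs ! Suc j else xs ! Suc j)"
proof -
  consider "i = 0" | "i = length xs" "i \<noteq> 0" | "i \<noteq> 0" "i < length xs" using assms by linarith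
  then show ?thesis
  proof cases
    case 3
    then have "min (i - 1) (length xs) = i - 1" "min (length xs) (i - Suc 0) = i - 1" by auto
    with 3 assms show ?thesis
      by (auto simp: face_def merge_at_def nth_append nth_Cons' Suc_diff_Suc min_def not_less_iff_gr_or_eq)
  qed (use assms in \<open>auto simp: face_def nth_tl nth_butlast\<close>)
qed

lemma nth_closed: "xs \<in> tuples G n \<Longrightarrow> j < n \<Longrightarrow> xs ! j \<in> carrier G"
  by (auto simp: tuples_def)

lemma tuples_nthI: "length xs = n \<Longrightarrow> (\<And>j. j < n \<Longrightarrow> xs ! j \<in> carrier G) \<Longrightarrow> xs \<in> tuples G n"
  by (auto simp: tuples_def in_set_conv_nth)

lemma length_tuples: "xs \<in> tuples G n \<Longrightarrow> length xs = n"
  by (simp add: tuples_def)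

lemma face_closed [simp]:
  assumes "xs \<in> tuples G (Suc n)" "i \<le> Suc n"
  shows "face i xs \<in> tuples G n"
proof (rule tuples_nthI)
  have l: "length xs = Suc n" "xs \<noteq> []" using assms(1) by (auto simp: tuples_def)
  show "length (face i xs) = n" using length_face l assms by simp
  show "face i xs ! j \<in> carrier G" if "j < n" for j
    using that l assms nth_closed[OF assms(1)] by (simp add: nth_face)
qed

text \<open>
  The simplicial identities. The two sides differ in bracketing only where two merges meet in
  one entry (\<open>i = j\<close>), and this is where associativity enters.
\<close>

lemma face_face:
  assumes "xs \<in> tuples G (Suc (Suc n))" "j \<le> i" "i \<le> Suc n"
  shows "face j (face (Suc i) xs) = face i (face j xs)"
proof (rule nth_equalityI)
  have l: "length xs = Suc (Suc n)" using assms(1) by (simp add: tuples_def)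
  have t: "face (Suc i) xs \<in> tuples G (Suc n)" "face j xs \<in> tuples G (Suc n)"
    using assms by auto
  have tt: "face j (face (Suc i) xs) \<in> tuples G n" "face i (face j xs) \<in> tuples G n"
    using t assms by auto
  show "length (face j (face (Suc i) xs)) = length (face i (face j xs))"
    using tt by (simp add: tuples_def)
  fix r assume "r < length (face j (face (Suc i) xs))"
  then have r: "r < n" using tt by (simp add: tuples_def)
  have c: "xs ! r \<in> carrier G" "xs ! Suc r \<in> carrier G" "xs ! Suc (Suc r) \<in> carrier G"
    using nth_closed[OF assms(1)] r by auto
  show "face j (face (Suc i) xs) ! r = face i (face j xs) ! r"
  proof (cases "j = Suc r \<and> i = Suc r")
    case True
    then show ?thesis
      using r l c t[THEN length_tuples] by (simp add: nth_face G.m_assoc)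
  next
    case False
    then show ?thesis
      using r assms(2,3) l t[THEN length_tuples] by (cases "j = Suc r") (simp_all add: nth_face)
  qed
qed

lemma tuples_0 [simp]: "tuples G 0 = {[]}"
  by (auto simp: tuples_def)

lemma mem_tuples_2 [simp]: "[a, b] \<in> tuples G 2 \<longleftrightarrow> a \<in> carrier G \<and> b \<in> carrier G"
  by (auto simp: tuples_def)

section \<open>Cochains\<close>

lemma group_cochain: "comm_group (cochain_group G K n)"
proof (rule group.group_comm_groupI)
  show "group (cochain_group G K n)"
    unfolding cochain_group_def by (simp add: K.a_group)
  fix f g assume "f \<in> carrier (cochain_group G K n)" "g \<in> carrier (cochain_group G K n)"
  then show "f \<otimes>\<^bsub>cochain_group G K n\<^esub> g = g \<otimes>\<^bsub>cochain_group G K n\<^esub> f"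
    by (auto simp: cochain_group_def PiE_iff K.a_comm intro!: restrict_ext)
qed

lemma mem_cochain:
  "f \<in> carrier (cochain_group G K n) \<longleftrightarrow> f \<in> tuples G n \<rightarrow>\<^sub>E carrier K"
  by (simp add: cochain_group_def)

lemma cochain_closed:
  "f \<in> carrier (cochain_group G K n) \<Longrightarrow> xs \<in> tuples G n \<Longrightarrow> f xs \<in> carrier K"
  by (auto simp: mem_cochain)

lemma mult_cochain: "xs \<in> tuples G n \<Longrightarrow>
    (f \<otimes>\<^bsub>cochain_group G K n\<^esub> g) xs = f xs \<oplus>\<^bsub>K\<^esub> g xs"
  by (simp add: cochain_group_def)

lemma one_cochain: "\<one>\<^bsub>cochain_group G K n\<^esub> = (\<lambda>xs\<in>tuples G n. \<zero>\<^bsub>K\<^esub>)"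
  by (simp add: cochain_group_def)

lemma cochain_eqI:
  "f \<in> carrier (cochain_group G K n) \<Longrightarrow> g \<in> carrier (cochain_group G K n) \<Longrightarrow>
    (\<And>xs. xs \<in> tuples G n \<Longrightarrow> f xs = g xs) \<Longrightarrow> f = g"
  unfolding mem_cochain by (rule PiE_ext)

lemma coboundary_faces:
  assumes f: "f \<in> carrier (cochain_group G K n)" and xs: "xs \<in> tuples G (Suc n)"
  shows "coboundary_map G K n f xs = (\<Oplus>\<^bsub>K\<^esub>i\<in>{..Suc n}. sgn i \<otimes>\<^bsub>K\<^esub> f (face i xs))"
proof -
  define t where "t i = sgn i \<otimes>\<^bsub>K\<^esub> f (face i xs)" for i
  have c: "t i \<in> carrier K" if "i \<le> Suc n" for i
    using that xs cochain_closed[OF f] by (simp add: t_def del: K.nat_pow_Suc)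
  have l: "length xs = Suc n" using xs by (simp add: tuples_def)
  have "{..Suc n} = insert 0 (insert (Suc n) {1..n})" by auto
  then have "(\<Oplus>\<^bsub>K\<^esub>i\<in>{..Suc n}. t i) = (\<Oplus>\<^bsub>K\<^esub>i\<in>insert 0 (insert (Suc n) {1..n}). t i)"
    by (simp only:)
  also have "\<dots> = t 0 \<oplus>\<^bsub>K\<^esub> (t (Suc n) \<oplus>\<^bsub>K\<^esub> (\<Oplus>\<^bsub>K\<^esub>i\<in>{1..n}. t i))"
    using c by (subst K.finsum_insert, simp, simp, force, simp, subst K.finsum_insert) auto
  also have "\<dots> = t 0 \<oplus>\<^bsub>K\<^esub> (\<Oplus>\<^bsub>K\<^esub>i\<in>{1..n}. t i) \<oplus>\<^bsub>K\<^esub> t (Suc n)"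
    using c K.finsum_closed[of t "{1..n}"] by (simp add: Pi_def K.a_assoc K.a_comm[of "t (Suc n)"])
  also have "(\<Oplus>\<^bsub>K\<^esub>i\<in>{1..n}. t i) = (\<Oplus>\<^bsub>K\<^esub>i\<in>{1..n}. sgn i \<otimes>\<^bsub>K\<^esub> f (merge_at G i xs))"
  proof (rule K.finsum_cong')
    fix i assume "i \<in> {1..n}"
    then show "t i = sgn i \<otimes>\<^bsub>K\<^esub> f (merge_at G i xs)"
      using l by (auto simp: t_def face_def)
  next
    show "(\<lambda>i. sgn i \<otimes>\<^bsub>K\<^esub> f (merge_at G i xs)) \<in> {1..n} \<rightarrow> carrier K"
    proof
      fix i assume "i \<in> {1..n}"
      then show "sgn i \<otimes>\<^bsub>K\<^esub> f (merge_at G i xs) \<in> carrier K"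
        using l c[of i] by (simp add: t_def face_def)
    qed
  qed simp
  also have "t 0 = f (tl xs)"
    using cochain_closed[OF f, of "tl xs"] face_closed[OF xs, of 0] by (simp add: t_def face_def)
  also have "t (Suc n) = sgn (Suc n) \<otimes>\<^bsub>K\<^esub> f (butlast xs)"
    using l by (simp add: t_def face_def)
  finally show ?thesis
    using xs by (simp add: coboundary_map_def t_def del: K.nat_pow_Suc)
qed

lemma coboundary_closed:
  assumes f: "f \<in> carrier (cochain_group G K n)"
  shows "coboundary_map G K n f \<in> carrier (cochain_group G K (Suc n))"
proof -
  have "coboundary_map G K n f xs \<in> carrier K" if "xs \<in> tuples G (Suc n)" for xs
    unfolding coboundary_faces[OF f that]
    by (rule K.finsum_closed) (use cochain_closed[OF f] that in auto)
  moreover have "coboundary_map G K n f xs = undefined" if "xs \<notin> tuples G (Suc n)" for xs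
    using that by (simp add: coboundary_map_def)
  ultimately show ?thesis by (auto simp: mem_cochain)
qed

lemma coboundary_hom:
  "group_hom (cochain_group G K n) (cochain_group G K (Suc n)) (coboundary_map G K n)"
proof -
  have "coboundary_map G K n (f \<otimes>\<^bsub>cochain_group G K n\<^esub> g) =
      coboundary_map G K n f \<otimes>\<^bsub>cochain_group G K (Suc n)\<^esub> coboundary_map G K n g"
    if f: "f \<in> carrier (cochain_group G K n)" and g: "g \<in> carrier (cochain_group G K n)" for f g
  proof (rule cochain_eqI)
    interpret C: comm_group "cochain_group G K n" by (rule group_cochain)
    interpret C': comm_group "cochain_group G K (Suc n)" by (rule group_cochain)
    have fg: "f \<otimes>\<^bsub>cochain_group G K n\<^esub> g \<in> carrier (cochain_group G K n)"
      using f g by simp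
    show "coboundary_map G K n (f \<otimes>\<^bsub>cochain_group G K n\<^esub> g) \<in> carrier (cochain_group G K (Suc n))"
      using coboundary_closed fg by blast
    show "coboundary_map G K n f \<otimes>\<^bsub>cochain_group G K (Suc n)\<^esub> coboundary_map G K n g
        \<in> carrier (cochain_group G K (Suc n))"
      using coboundary_closed f g by blast
    fix xs assume xs: "xs \<in> tuples G (Suc n)"
    have c: "f (face i xs) \<in> carrier K" "g (face i xs) \<in> carrier K" if "i \<le> Suc n" for i
      using that f g xs by (auto intro!: cochain_closed)
    have "coboundary_map G K n (f \<otimes>\<^bsub>cochain_group G K n\<^esub> g) xs =
        (\<Oplus>\<^bsub>K\<^esub>i\<in>{..Suc n}. sgn i \<otimes>\<^bsub>K\<^esub> f (face i xs) \<oplus>\<^bsub>K\<^esub> sgn i \<otimes>\<^bsub>K\<^esub> g (face i xs))"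
      unfolding coboundary_faces[OF fg xs]
      by (rule K.finsum_cong') (use c xs in \<open>auto simp: mult_cochain K.r_distr\<close>)
    also have "\<dots> = coboundary_map G K n f xs \<oplus>\<^bsub>K\<^esub> coboundary_map G K n g xs"
      unfolding coboundary_faces[OF f xs] coboundary_faces[OF g xs]
      by (rule K.finsum_addf) (use c in auto)
    finally show "coboundary_map G K n (f \<otimes>\<^bsub>cochain_group G K n\<^esub> g) xs =
        (coboundary_map G K n f \<otimes>\<^bsub>cochain_group G K (Suc n)\<^esub> coboundary_map G K n g) xs"
      using xs by (simp add: mult_cochain)
  qed
  then show ?thesis
    using group_cochain coboundary_closed
    by (auto simp: group_hom_def group_hom_axioms_def hom_def comm_group_def)
qed

text \<open>
  The combinatorial half of \<open>d \<circ> d = 0\<close>. Passing from \<open>n\<close> to \<open>n + 1\<close> adds the row \<open>n + 2\<close> and the column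
  \<open>n + 1\<close> to the index rectangle, and by hypothesis their entries cancel in pairs.
\<close>

lemma antisymmetric_double_sum_vanishes:
  assumes "\<And>i j. T i j \<in> carrier K"
    and "\<And>i j. j \<le> i \<Longrightarrow> i \<le> n \<Longrightarrow> T (Suc i) j = \<ominus>\<^bsub>K\<^esub> T j i"
  shows "(\<Oplus>\<^bsub>K\<^esub>j\<in>{..Suc n}. \<Oplus>\<^bsub>K\<^esub>i\<in>{..n}. T j i) = \<zero>\<^bsub>K\<^esub>"
  using assms(2)
proof (induction n)
  case 0
  have "T (Suc 0) 0 = \<ominus>\<^bsub>K\<^esub> T 0 0" by (rule 0) simp_all
  moreover have "(\<Oplus>\<^bsub>K\<^esub>i\<in>{..0::nat}. T j i) = T j 0" for j
    using assms(1) by simp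
  moreover have "(\<Oplus>\<^bsub>K\<^esub>j\<in>{..Suc 0}. T j 0) = T (Suc 0) 0 \<oplus>\<^bsub>K\<^esub> T 0 0"
    using assms(1) by simp
  ultimately show ?case
    using K.l_neg[OF assms(1)] by simp
next
  case (Suc n)
  have IH: "(\<Oplus>\<^bsub>K\<^esub>j\<in>{..Suc n}. \<Oplus>\<^bsub>K\<^esub>i\<in>{..n}. T j i) = \<zero>\<^bsub>K\<^esub>"
    by (rule Suc.IH, rule Suc.prems) simp_all
  have anti: "T (Suc (Suc n)) i = \<ominus>\<^bsub>K\<^esub> T i (Suc n)" if "i \<in> {..Suc n}" for i
    by (rule Suc.prems) (use that in auto)
  have "(\<Oplus>\<^bsub>K\<^esub>j\<in>{..Suc (Suc n)}. \<Oplus>\<^bsub>K\<^esub>i\<in>{..Suc n}. T j i) =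
      (\<Oplus>\<^bsub>K\<^esub>i\<in>{..Suc n}. T (Suc (Suc n)) i) \<oplus>\<^bsub>K\<^esub> (\<Oplus>\<^bsub>K\<^esub>j\<in>{..Suc n}. \<Oplus>\<^bsub>K\<^esub>i\<in>{..Suc n}. T j i)"
    by (rule K.finsum_Suc) (simp add: assms(1) Pi_def)
  also have "(\<Oplus>\<^bsub>K\<^esub>j\<in>{..Suc n}. \<Oplus>\<^bsub>K\<^esub>i\<in>{..Suc n}. T j i) =
      (\<Oplus>\<^bsub>K\<^esub>j\<in>{..Suc n}. T j (Suc n) \<oplus>\<^bsub>K\<^esub> (\<Oplus>\<^bsub>K\<^esub>i\<in>{..n}. T j i))"
    by (rule K.finsum_cong') (simp_all add: assms(1) Pi_def)
  also have "\<dots> = (\<Oplus>\<^bsub>K\<^esub>j\<in>{..Suc n}. T j (Suc n)) \<oplus>\<^bsub>K\<^esub> (\<Oplus>\<^bsub>K\<^esub>j\<in>{..Suc n}. \<Oplus>\<^bsub>K\<^esub>i\<in>{..n}. T j i)"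
    by (rule K.finsum_addf) (simp_all add: assms(1) Pi_def)
  also have "(\<Oplus>\<^bsub>K\<^esub>i\<in>{..Suc n}. T (Suc (Suc n)) i) = (\<Oplus>\<^bsub>K\<^esub>j\<in>{..Suc n}. \<ominus>\<^bsub>K\<^esub> T j (Suc n))"
    by (rule K.finsum_cong') (simp_all add: anti assms(1))
  also have "\<dots> \<oplus>\<^bsub>K\<^esub> ((\<Oplus>\<^bsub>K\<^esub>j\<in>{..Suc n}. T j (Suc n)) \<oplus>\<^bsub>K\<^esub> (\<Oplus>\<^bsub>K\<^esub>j\<in>{..Suc n}. \<Oplus>\<^bsub>K\<^esub>i\<in>{..n}. T j i)) =
      (\<Oplus>\<^bsub>K\<^esub>j\<in>{..Suc n}. \<ominus>\<^bsub>K\<^esub> T j (Suc n)) \<oplus>\<^bsub>K\<^esub> (\<Oplus>\<^bsub>K\<^esub>j\<in>{..Suc n}. T j (Suc n))"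
    unfolding IH by (simp add: assms(1) Pi_def del: K.finsum_Suc)
  also have "\<dots> = (\<Oplus>\<^bsub>K\<^esub>j\<in>{..Suc n}. \<ominus>\<^bsub>K\<^esub> T j (Suc n) \<oplus>\<^bsub>K\<^esub> T j (Suc n))"
    by (rule K.finsum_addf[symmetric]) (simp_all add: assms(1))
  also have "\<dots> = \<zero>\<^bsub>K\<^esub>"
    by (simp add: assms(1) K.l_neg del: K.finsum_Suc)
  finally show ?case .
qed

lemma coboundary_coboundary:
  assumes f: "f \<in> carrier (cochain_group G K n)"
  shows "coboundary_map G K (Suc n) (coboundary_map G K n f) = \<one>\<^bsub>cochain_group G K (Suc (Suc n))\<^esub>"
proof (rule cochain_eqI)
  interpret C: comm_group "cochain_group G K (Suc (Suc n))" by (rule group_cochain)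
  show "coboundary_map G K (Suc n) (coboundary_map G K n f)
      \<in> carrier (cochain_group G K (Suc (Suc n)))"
    using f by (intro coboundary_closed)
  show "\<one>\<^bsub>cochain_group G K (Suc (Suc n))\<^esub> \<in> carrier (cochain_group G K (Suc (Suc n)))" by simp
  fix xs assume xs: "xs \<in> tuples G (Suc (Suc n))"
  \<comment> \<open>The value outside the index rectangle only serves to make the entries total in \<open>K\<close>.\<close>
  define T where "T j i = (if j \<le> Suc (Suc n) \<and> i \<le> Suc n
    then sgn (i + j) \<otimes>\<^bsub>K\<^esub> f (face i (face j xs)) else \<zero>\<^bsub>K\<^esub>)" for j i
  have c: "f (face i (face j xs)) \<in> carrier K" if "j \<le> Suc (Suc n)" "i \<le> Suc n" for i j
    using that f xs by (auto intro!: cochain_closed)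
  have "coboundary_map G K (Suc n) (coboundary_map G K n f) xs =
      (\<Oplus>\<^bsub>K\<^esub>j\<in>{..Suc (Suc n)}. \<Oplus>\<^bsub>K\<^esub>i\<in>{..Suc n}. T j i)"
    unfolding coboundary_faces[OF coboundary_closed[OF f] xs]
  proof (rule K.finsum_cong')
    show "(\<lambda>j. \<Oplus>\<^bsub>K\<^esub>i\<in>{..Suc n}. T j i) \<in> {..Suc (Suc n)} \<rightarrow> carrier K"
      using c by (intro Pi_I K.finsum_closed) (auto simp: T_def)
    fix j assume "j \<in> {..Suc (Suc n)}"
    then have j: "j \<le> Suc (Suc n)" by simp
    have "sgn j \<otimes>\<^bsub>K\<^esub> coboundary_map G K n f (face j xs) =
        (\<Oplus>\<^bsub>K\<^esub>i\<in>{..Suc n}. sgn j \<otimes>\<^bsub>K\<^esub> (sgn i \<otimes>\<^bsub>K\<^esub> f (face i (face j xs))))"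
      using j c xs by (subst coboundary_faces[OF f], simp, subst K.finsum_rdistr) auto
    also have "\<dots> = (\<Oplus>\<^bsub>K\<^esub>i\<in>{..Suc n}. T j i)"
      by (rule K.finsum_cong')
        (use j c in \<open>auto simp: T_def K.m_assoc[symmetric] K.nat_pow_mult add.commute\<close>)
    finally show "sgn j \<otimes>\<^bsub>K\<^esub> coboundary_map G K n f (face j xs) = (\<Oplus>\<^bsub>K\<^esub>i\<in>{..Suc n}. T j i)" .
  qed simp
  also have "\<dots> = \<zero>\<^bsub>K\<^esub>"
  proof (rule antisymmetric_double_sum_vanishes)
    show "T i j \<in> carrier K" for i j using c by (simp add: T_def)
    fix i j assume ji: "j \<le> i" "i \<le> Suc n"
    then show "T (Suc i) j = \<ominus>\<^bsub>K\<^esub> T j i"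
      using face_face[OF xs ji] c[of j i] c[of "Suc i" j]
      by (simp add: T_def add.commute K.l_minus K.r_minus)
  qed
  finally show "coboundary_map G K (Suc n) (coboundary_map G K n f) xs =
      \<one>\<^bsub>cochain_group G K (Suc (Suc n))\<^esub> xs"
    using xs by (simp add: one_cochain)
qed

section \<open>Cocycles and cohomology classes\<close>

abbreviation C where "C n \<equiv> cochain_group G K n"
abbreviation Z where "Z n \<equiv> cocycle_group G K n"
abbreviation B where "B n \<equiv> coboundaries G K n"
abbreviation HH where "HH n \<equiv> cohomology_group G K n"
abbreviation cls where "cls n \<equiv> cohomology_class G K n"
abbreviation d where "d n \<equiv> coboundary_map G K n"

lemma mult_cocycle [simp]: "monoid.mult (Z n) = monoid.mult (C n)"
  and one_cocycle [simp]: "\<one>\<^bsub>Z n\<^esub> = \<one>\<^bsub>C n\<^esub>"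
  by (simp_all add: cocycle_group_def)

lemma mem_cocycle: "f \<in> carrier (Z n) \<longleftrightarrow> f \<in> carrier (C n) \<and> d n f = \<one>\<^bsub>C (Suc n)\<^esub>"
  by (simp add: cocycle_group_def kernel_def)

lemma cocycleI:
  "f \<in> carrier (C n) \<Longrightarrow> (\<And>xs. xs \<in> tuples G (Suc n) \<Longrightarrow> d n f xs = \<zero>\<^bsub>K\<^esub>) \<Longrightarrow> f \<in> carrier (Z n)"
  unfolding mem_cocycle
proof
  interpret C': comm_group "C (Suc n)" by (rule group_cochain)
  assume f: "f \<in> carrier (C n)" and "\<And>xs. xs \<in> tuples G (Suc n) \<Longrightarrow> d n f xs = \<zero>\<^bsub>K\<^esub>"
  then show "d n f = \<one>\<^bsub>C (Suc n)\<^esub>"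
    by (intro cochain_eqI[OF coboundary_closed[OF f] C'.one_closed]) (simp add: one_cochain)
qed

lemma subgroup_cocycles: "subgroup (carrier (Z n)) (C n)"
  unfolding cocycle_group_def by (simp add: group_hom.subgroup_kernel coboundary_hom)

lemma comm_group_cocycle: "comm_group (Z n)"
proof -
  interpret C: comm_group "C n" by (rule group_cochain)
  have "Z n = C n \<lparr>carrier := carrier (Z n)\<rparr>" by (simp add: cocycle_group_def)
  then have "group (Z n)"
    using subgroup.subgroup_is_group[OF subgroup_cocycles C.is_group] by metis
  then show ?thesis
    by (rule group.group_comm_groupI) (auto simp: mem_cocycle C.m_comm)
qed

lemma coboundaries_subset: "B n \<subseteq> carrier (Z n)"
proof (cases n)
  case 0
  show ?thesis
    using subgroup.one_closed[OF subgroup_cocycles] by (simp add: coboundaries_def 0)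
next
  case (Suc m)
  then show ?thesis
    by (auto simp: coboundaries_def mem_cocycle coboundary_closed coboundary_coboundary)
qed

lemma subgroup_coboundaries: "subgroup (B n) (C n)"
proof (cases n)
  case 0
  interpret C: comm_group "C n" by (rule group_cochain)
  show ?thesis
    using C.triv_subgroup by (simp add: coboundaries_def 0)
next
  case (Suc m)
  then show ?thesis
    using group_hom.img_is_subgroup[OF coboundary_hom] by (simp add: coboundaries_def)
qed

lemma subgroup_coboundaries_cocycle: "subgroup (B n) (Z n)"
proof -
  interpret C: comm_group "C n" by (rule group_cochain)
  have "Z n = C n \<lparr>carrier := carrier (Z n)\<rparr>" by (simp add: cocycle_group_def)
  with C.subgroup_incl[OF subgroup_coboundaries subgroup_cocycles coboundaries_subset]
  show ?thesis by metis
qed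

lemma comm_group_cohomology: "comm_group (HH n)"
  unfolding cohomology_group_def
  using comm_group.abelian_FactGroup[OF comm_group_cocycle subgroup_coboundaries_cocycle] .

lemma one_cohomology [simp]: "\<one>\<^bsub>HH n\<^esub> = B n"
  by (simp add: cohomology_group_def)

lemma mem_cohomology: "A \<in> carrier (HH n) \<longleftrightarrow> (\<exists>f\<in>carrier (Z n). A = cls n f)"
  by (auto simp: cohomology_group_def carrier_FactGroup cohomology_class_def)

lemma class_closed: "f \<in> carrier (Z n) \<Longrightarrow> cls n f \<in> carrier (HH n)"
  by (auto simp: mem_cohomology)

lemma mem_class: "g \<in> cls n f \<longleftrightarrow> (\<exists>b\<in>B n. g = b \<otimes>\<^bsub>C n\<^esub> f)"
  by (auto simp: cohomology_class_def r_coset_def)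

lemma class_self: "f \<in> carrier (Z n) \<Longrightarrow> f \<in> cls n f"
proof -
  interpret Z: comm_group "Z n" by (rule comm_group_cocycle)
  show "f \<in> carrier (Z n) \<Longrightarrow> f \<in> cls n f"
    unfolding cohomology_class_def by (rule Z.rcos_self[OF _ subgroup_coboundaries_cocycle])
qed

lemma representative:
  assumes "A \<in> carrier (HH n)" "f \<in> A"
  shows "f \<in> carrier (Z n)" "A = cls n f"
proof -
  interpret Z: comm_group "Z n" by (rule comm_group_cocycle)
  obtain g where g: "g \<in> carrier (Z n)" "A = cls n g" using assms(1) by (auto simp: mem_cohomology)
  then have f: "f \<in> B n #>\<^bsub>Z n\<^esub> g" using assms(2) by (simp add: cohomology_class_def)
  show "A = cls n f"
    unfolding g(2) cohomology_class_def
    by (rule Z.repr_independence[OF f g(1) subgroup_coboundaries_cocycle])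
  show "f \<in> carrier (Z n)"
    using f g Z.r_coset_subset_G[OF subgroup.subset[OF subgroup_coboundaries_cocycle]] by blast
qed

lemma class_nonempty: "A \<in> carrier (HH n) \<Longrightarrow> \<exists>f. f \<in> A"
  using class_self by (auto simp: mem_cohomology)

lemma class_coboundary: "f \<in> B n \<Longrightarrow> cls n f = B n"
  unfolding cohomology_class_def
  using group.coset_join2[OF comm_group.axioms(2)[OF comm_group_cocycle]
      _ subgroup_coboundaries_cocycle] coboundaries_subset by blast

lemma class_add_coboundary:
  assumes "f \<in> carrier (Z n)" "b \<in> B n"
  shows "cls n (b \<otimes>\<^bsub>C n\<^esub> f) = cls n f"
  using representative(2)[OF class_closed[OF assms(1)]] assms(2) by (metis mem_class)

lemma coboundaries_0: "B 0 = {\<one>\<^bsub>C 0\<^esub>}"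
  by (simp add: coboundaries_def)

text \<open>
  Both faces of a \<open>1\<close>-tuple are the empty tuple and enter with opposite signs. So there are no
  nonzero \<open>1\<close>-coboundaries, and classes of degree at most \<open>1\<close> are single cocycles.
\<close>

lemma coboundary_0: "f \<in> carrier (C 0) \<Longrightarrow> d 0 f = \<one>\<^bsub>C 1\<^esub>"
proof (rule cochain_eqI)
  interpret C': comm_group "C 1" by (rule group_cochain)
  assume f: "f \<in> carrier (C 0)"
  show "d 0 f \<in> carrier (C 1)" using coboundary_closed[OF f] by simp
  show "\<one>\<^bsub>C 1\<^esub> \<in> carrier (C 1)" by (rule C'.one_closed)
  fix xs assume xs: "xs \<in> tuples G 1"
  then obtain a where "xs = [a]" by (auto simp: tuples_def length_Suc_conv)
  then show "d 0 f xs = \<one>\<^bsub>C 1\<^esub> xs"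
    using xs cochain_closed[OF f, of "[]"]
    by (simp add: coboundary_map_def one_cochain K.l_minus K.r_neg)
qed

lemma coboundaries_1: "B 1 = {\<one>\<^bsub>C 1\<^esub>}"
proof -
  interpret C0: comm_group "C 0" by (rule group_cochain)
  have "carrier (C 0) \<noteq> {}" using C0.one_closed by blast
  then show ?thesis by (auto simp: coboundaries_def coboundary_0[simplified])
qed

lemma class_low_degree: "n \<le> 1 \<Longrightarrow> f \<in> carrier (Z n) \<Longrightarrow> cls n f = {f}"
proof -
  interpret C: comm_group "C n" by (rule group_cochain)
  assume n: "n \<le> 1" and f: "f \<in> carrier (Z n)"
  have "B n = {\<one>\<^bsub>C n\<^esub>}"
    using n coboundaries_0 coboundaries_1 by (cases n) auto
  then show ?thesis using f by (auto simp: mem_class set_eq_iff mem_cocycle)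
qed

lemma coboundary_1:
  assumes "f \<in> carrier (C 1)" "a \<in> carrier G" "b \<in> carrier G"
  shows "d 1 f [a, b] = f [b] \<ominus>\<^bsub>K\<^esub> f [a \<otimes>\<^bsub>G\<^esub> b] \<oplus>\<^bsub>K\<^esub> f [a]"
proof -
  have [simp]: "f [x] \<in> carrier K" if "x \<in> carrier G" for x
    using cochain_closed[OF assms(1), of "[x]"] that by (simp add: tuples_def)
  show ?thesis
    using assms by (simp add: coboundary_map_def tuples_def merge_at_def a_minus_def
        K.l_minus K.r_minus)
qed

lemma coboundary_2:
  assumes "f \<in> carrier (C 2)" "a \<in> carrier G" "b \<in> carrier G" "c \<in> carrier G"
  shows "d 2 f [a, b, c] =
    f [b, c] \<ominus>\<^bsub>K\<^esub> f [a \<otimes>\<^bsub>G\<^esub> b, c] \<oplus>\<^bsub>K\<^esub> f [a, b \<otimes>\<^bsub>G\<^esub> c] \<ominus>\<^bsub>K\<^esub> f [a, b]"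
proof -
  have [simp]: "f [x, y] \<in> carrier K" if "x \<in> carrier G" "y \<in> carrier G" for x y
    using cochain_closed[OF assms(1), of "[x, y]"] that by simp
  have "{1..2::nat} = {1, 2}" by auto
  then show ?thesis
    using assms by (simp add: coboundary_map_def tuples_def merge_at_def a_minus_def
        K.l_minus K.r_minus K.a_ac numeral_2_eq_2)
qed

lemma cocycle_1_hom:
  assumes "f \<in> carrier (Z 1)" "a \<in> carrier G" "b \<in> carrier G"
  shows "f [a \<otimes>\<^bsub>G\<^esub> b] = f [a] \<oplus>\<^bsub>K\<^esub> f [b]"
proof -
  have f: "f \<in> carrier (C 1)" and df: "d 1 f = \<one>\<^bsub>C (Suc 1)\<^esub>"
    using assms(1) by (auto simp: mem_cocycle)
  have c: "f [x] \<in> carrier K" if "x \<in> carrier G" for x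
    using cochain_closed[OF f, of "[x]"] that by (simp add: tuples_def)
  have "f [b] \<ominus>\<^bsub>K\<^esub> f [a \<otimes>\<^bsub>G\<^esub> b] \<oplus>\<^bsub>K\<^esub> f [a] = \<zero>\<^bsub>K\<^esub>"
    using coboundary_1[OF f assms(2,3)] df assms(2,3) by (simp add: one_cochain tuples_def)
  then have "f [a] \<oplus>\<^bsub>K\<^esub> f [b] \<ominus>\<^bsub>K\<^esub> f [a \<otimes>\<^bsub>G\<^esub> b] = \<zero>\<^bsub>K\<^esub>"
    using c assms by (simp add: a_minus_def K.a_ac)
  then show ?thesis
    using c assms by simp
qed

section \<open>Cup products in low degrees\<close>

text \<open>
  The component of degree \<open>2\<close> of a product only involves \<open>H\<^sup>0 \<union> H\<^sup>2\<close>, \<open>H\<^sup>1 \<union> H\<^sup>1\<close> and \<open>H\<^sup>2 \<union> H\<^sup>0\<close>. Products with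
  degree \<open>0\<close> are scalings, which visibly preserve coboundaries, and in degree \<open>1\<close> representatives are
  unique; so in these cases the cup product of classes is the class of the product of any
  representatives.
\<close>

lemma cup_cochain_closed:
  assumes "f \<in> carrier (C m)" "g \<in> carrier (C n)"
  shows "cup_cochain G K m n f g \<in> carrier (C (m + n))"
proof -
  have "take m xs \<in> tuples G m" "drop m xs \<in> tuples G n" if "xs \<in> tuples G (m + n)" for xs
    using that by (auto simp: tuples_def dest: in_set_takeD in_set_dropD)
  then show ?thesis
    using assms[THEN cochain_closed] by (auto simp: mem_cochain cup_cochain_def)
qed

definition scale where "scale n c f = (\<lambda>xs\<in>tuples G n. c \<otimes>\<^bsub>K\<^esub> f xs)"

lemma scale_closed: "c \<in> carrier K \<Longrightarrow> f \<in> carrier (C n) \<Longrightarrow> scale n c f \<in> carrier (C n)"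
  by (auto simp: mem_cochain scale_def)

lemma coboundary_scale:
  assumes c: "c \<in> carrier K" and f: "f \<in> carrier (C n)"
  shows "d n (scale n c f) = scale (Suc n) c (d n f)"
proof (rule cochain_eqI)
  show "d n (scale n c f) \<in> carrier (C (Suc n))"
    "scale (Suc n) c (d n f) \<in> carrier (C (Suc n))"
    using c f by (simp_all add: coboundary_closed scale_closed)
  fix xs assume xs: "xs \<in> tuples G (Suc n)"
  have k: "f (face i xs) \<in> carrier K" if "i \<le> Suc n" for i
    using that f xs by (auto intro: cochain_closed)
  have "d n (scale n c f) xs = (\<Oplus>\<^bsub>K\<^esub>i\<in>{..Suc n}. c \<otimes>\<^bsub>K\<^esub> (sgn i \<otimes>\<^bsub>K\<^esub> f (face i xs)))"
    unfolding coboundary_faces[OF scale_closed[OF c f] xs]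
    by (rule K.finsum_cong') (use c k xs in \<open>auto simp: scale_def K.m_lcomm\<close>)
  also have "\<dots> = c \<otimes>\<^bsub>K\<^esub> d n f xs"
    unfolding coboundary_faces[OF f xs]
    by (rule K.finsum_rdistr[symmetric]) (use c k in auto)
  finally show "d n (scale n c f) xs = scale (Suc n) c (d n f) xs"
    using xs by (simp add: scale_def)
qed

lemma scale_cocycle: "c \<in> carrier K \<Longrightarrow> f \<in> carrier (Z n) \<Longrightarrow> scale n c f \<in> carrier (Z n)"
  by (auto simp: mem_cocycle scale_closed coboundary_scale) (auto simp: scale_def one_cochain)

lemma scale_coboundary:
  assumes c: "c \<in> carrier K" and f: "f \<in> B n"
  shows "scale n c f \<in> B n"
proof (cases n)
  case 0
  then show ?thesis using assms by (auto simp: scale_def coboundaries_def one_cochain)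
next
  case (Suc m)
  then obtain u where "u \<in> carrier (C m)" "f = d m u" using f by (auto simp: coboundaries_def)
  then have "scale n c f = d m (scale m c u)" "scale m c u \<in> carrier (C m)"
    using c by (simp_all add: coboundary_scale scale_closed Suc)
  then show ?thesis by (auto simp: coboundaries_def Suc)
qed

lemma scale_mult:
  assumes "c \<in> carrier K" "f \<in> carrier (C n)" "g \<in> carrier (C n)"
  shows "scale n c (f \<otimes>\<^bsub>C n\<^esub> g) = scale n c f \<otimes>\<^bsub>C n\<^esub> scale n c g"
proof -
  interpret C: comm_group "C n" by (rule group_cochain)
  show ?thesis
  proof (rule cochain_eqI)
    show "scale n c (f \<otimes>\<^bsub>C n\<^esub> g) \<in> carrier (C n)"
      "scale n c f \<otimes>\<^bsub>C n\<^esub> scale n c g \<in> carrier (C n)"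
      using assms by (simp_all add: scale_closed)
  qed (use assms in \<open>simp add: scale_def mult_cochain cochain_closed K.r_distr\<close>)
qed

lemma cup_cochain_0_left: "cup_cochain G K 0 n f g = scale n (f []) g"
  by (simp add: cup_cochain_def scale_def)

lemma cup_cochain_0_right:
  assumes "f \<in> carrier (C n)" "g \<in> carrier (C 0)"
  shows "cup_cochain G K n 0 f g = scale n (g []) f"
  using assms cochain_closed[OF assms(1)] cochain_closed[OF assms(2), of "[]"]
  by (auto simp: cup_cochain_def scale_def K.m_comm length_tuples intro!: restrict_ext)

lemma class_scale:
  assumes "c \<in> carrier K" "B' \<in> carrier (HH n)" "g \<in> B'" "g' \<in> B'"
  shows "cls n (scale n c g) = cls n (scale n c g')"
proof -
  have g: "g \<in> carrier (Z n)" "B' = cls n g" using representative assms by blast+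
  then obtain b where b: "b \<in> B n" "g' = b \<otimes>\<^bsub>C n\<^esub> g" using assms(4) by (auto simp: mem_class)
  then have "scale n c g' = scale n c b \<otimes>\<^bsub>C n\<^esub> scale n c g"
    using g assms(1) subgroup.subset[OF subgroup_coboundaries] by (auto simp: mem_cocycle intro!: scale_mult)
  then show ?thesis
    using class_add_coboundary[OF scale_cocycle scale_coboundary] assms(1) g b by metis
qed

lemma cup_class_eq:
  assumes "f \<in> A" "g \<in> A'"
    and "\<And>f' g'. f' \<in> A \<Longrightarrow> g' \<in> A' \<Longrightarrow>
      cls (m + n) (cup_cochain G K m n f' g') = cls (m + n) (cup_cochain G K m n f g)"
  shows "cup_class G K m n A A' = cls (m + n) (cup_cochain G K m n f g)"
  unfolding cup_class_def
proof (intro equalityI UN_least)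
  show "cls (m + n) (cup_cochain G K m n f' g') \<subseteq> cls (m + n) (cup_cochain G K m n f g)"
    if "f' \<in> A" "g' \<in> A'" for f' g'
    by (rule eq_refl, rule assms(3)[OF that])
qed (use assms(1,2) in blast)

lemma low_degree_unique:
  assumes "n \<le> 1" "A \<in> carrier (HH n)" "f \<in> A" "f' \<in> A"
  shows "f = f'"
  using assms representative class_low_degree by (metis singletonD)

lemma cup_class_0_left:
  assumes "A \<in> carrier (HH 0)" "A' \<in> carrier (HH n)" "f \<in> A" "g \<in> A'"
  shows "cup_class G K 0 n A A' = cls n (scale n (f []) g)"
    and "scale n (f []) g \<in> carrier (Z n)"
proof -
  have f: "f \<in> carrier (Z 0)" and g: "g \<in> carrier (Z n)" using representative assms by blast+
  then have c: "f [] \<in> carrier K" using cochain_closed[of f 0 "[]"] by (simp add: mem_cocycle)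
  have "cup_class G K 0 n A A' = cls (0 + n) (cup_cochain G K 0 n f g)"
  proof (rule cup_class_eq[OF assms(3,4)])
    fix f' g' assume "f' \<in> A" "g' \<in> A'"
    then show "cls (0 + n) (cup_cochain G K 0 n f' g') = cls (0 + n) (cup_cochain G K 0 n f g)"
      using low_degree_unique[OF _ assms(1) _ assms(3), of f'] class_scale[OF c assms(2) _ assms(4), of g']
      by (simp add: cup_cochain_0_left)
  qed
  then show "cup_class G K 0 n A A' = cls n (scale n (f []) g)"
    by (simp add: cup_cochain_0_left)
  show "scale n (f []) g \<in> carrier (Z n)" using scale_cocycle c g by blast
qed

lemma cup_class_0_right:
  assumes "A \<in> carrier (HH n)" "A' \<in> carrier (HH 0)" "f \<in> A" "g \<in> A'"
  shows "cup_class G K n 0 A A' = cls n (scale n (g []) f)"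
    and "scale n (g []) f \<in> carrier (Z n)"
proof -
  have f: "f \<in> carrier (Z n)" and g: "g \<in> carrier (Z 0)" using representative assms by blast+
  then have c: "g [] \<in> carrier K" using cochain_closed[of g 0 "[]"] by (simp add: mem_cocycle)
  have eq: "cup_cochain G K n 0 f' g' = scale n (g []) f'" if "f' \<in> A" "g' \<in> A'" for f' g'
  proof -
    have "g' = g" using low_degree_unique[OF _ assms(2)] that assms by simp
    moreover have "f' \<in> carrier (C n)" "g \<in> carrier (C 0)"
      using representative(1)[OF assms(1) that(1)] g by (simp_all add: mem_cocycle)
    ultimately show ?thesis by (simp add: cup_cochain_0_right)
  qed
  have "cup_class G K n 0 A A' = cls (n + 0) (cup_cochain G K n 0 f g)"
  proof (rule cup_class_eq[OF assms(3,4)])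
    fix f' g' assume "f' \<in> A" "g' \<in> A'"
    then show "cls (n + 0) (cup_cochain G K n 0 f' g') = cls (n + 0) (cup_cochain G K n 0 f g)"
      using class_scale[OF c assms(1) _ assms(3), of f'] assms(3,4) by (simp add: eq)
  qed
  then show "cup_class G K n 0 A A' = cls n (scale n (g []) f)"
    using assms eq by simp
  show "scale n (g []) f \<in> carrier (Z n)" using scale_cocycle c f by blast
qed

lemma cup_cochain_1_1_cocycle:
  assumes f: "f \<in> carrier (Z 1)" and g: "g \<in> carrier (Z 1)"
  shows "cup_cochain G K 1 1 f g \<in> carrier (Z 2)"
proof (rule cocycleI)
  show fg: "cup_cochain G K 1 1 f g \<in> carrier (C 2)"
    using cup_cochain_closed[of f 1 g 1] f g by (simp add: mem_cocycle numeral_2_eq_2)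
  fix xs assume "xs \<in> tuples G (Suc 2)"
  then obtain a b c where xs: "xs = [a, b, c]" "a \<in> carrier G" "b \<in> carrier G" "c \<in> carrier G"
    by (auto simp: tuples_def length_Suc_conv numeral_2_eq_2)
  have cf: "f [x] \<in> carrier K" "g [x] \<in> carrier K" if "x \<in> carrier G" for x
    using f g that cochain_closed[of _ 1 "[x]"] by (auto simp: mem_cocycle tuples_def)
  have cup: "cup_cochain G K 1 1 f g [x, y] = f [x] \<otimes>\<^bsub>K\<^esub> g [y]"
    if "x \<in> carrier G" "y \<in> carrier G" for x y
    using that by (simp add: cup_cochain_def tuples_def)
  show "d 2 (cup_cochain G K 1 1 f g) xs = \<zero>\<^bsub>K\<^esub>"
    unfolding xs(1) coboundary_2[OF fg xs(2-4)]
    using xs(2-4) cf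
    by (simp add: cup cocycle_1_hom[OF f] cocycle_1_hom[OF g] K.l_distr K.r_distr a_minus_def K.minus_add K.a_ac K.r_neg K.l_neg
      K.r_neg1 K.r_neg2 del: One_nat_def)
qed

lemma cup_class_1_1:
  assumes "A \<in> carrier (HH 1)" "A' \<in> carrier (HH 1)" "f \<in> A" "g \<in> A'"
  shows "cup_class G K 1 1 A A' = cls 2 (cup_cochain G K 1 1 f g)"
proof -
  have "cup_class G K 1 1 A A' = cls (1 + 1) (cup_cochain G K 1 1 f g)"
  proof (rule cup_class_eq[OF assms(3,4)])
    fix f' g' assume "f' \<in> A" "g' \<in> A'"
    then show "cls (1 + 1) (cup_cochain G K 1 1 f' g') = cls (1 + 1) (cup_cochain G K 1 1 f g)"
      using low_degree_unique[OF _ assms(1) _ assms(3), of f']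
        low_degree_unique[OF _ assms(2) _ assms(4), of g'] by simp
  qed
  then show ?thesis by (simp add: numeral_2_eq_2)
qed

section \<open>The cohomology ring\<close>

abbreviation R where "R \<equiv> cohomology_ring G K"

lemma group_cohomology: "group (HH n)"
  using comm_group_cohomology by (rule comm_group.axioms(2))

lemma carrier_R:
  "a \<in> carrier R \<longleftrightarrow> (\<forall>n. a n \<in> carrier (HH n)) \<and> finite {n. a n \<noteq> B n}"
  by (auto simp: cohomology_ring_def carrier_sum_group group_cohomology PiE_iff)

lemma component_closed: "a \<in> carrier R \<Longrightarrow> a n \<in> carrier (HH n)"
  by (simp add: carrier_R)

lemma add_R: "(a \<oplus>\<^bsub>R\<^esub> b) n = a n \<otimes>\<^bsub>HH n\<^esub> b n"
  by (simp add: cohomology_ring_def)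

lemma zero_R: "\<zero>\<^bsub>R\<^esub> n = B n"
  by (simp add: cohomology_ring_def)

lemma mult_R: "(a \<otimes>\<^bsub>R\<^esub> b) n = (\<Otimes>\<^bsub>HH n\<^esub>i\<in>{..n}. cup_class G K i (n - i) (a i) (b (n - i)))"
  by (simp add: cohomology_ring_def)

lemma homogeneous_mem_R:
  assumes "A \<in> carrier (HH n)"
  shows "(\<lambda>m. if m = n then A else B m) \<in> carrier R"
proof -
  have "B m \<in> carrier (HH m)" for m
    using monoid.one_closed[OF group.is_monoid[OF group_cohomology, of m]] by simp
  moreover have "{m. (if m = n then A else B m) \<noteq> B m} \<subseteq> {n}" by auto
  ultimately show ?thesis using assms by (auto simp: carrier_R intro: finite_subset)
qed

lemma carrier_R_proper: "carrier R \<noteq> UNIV"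
proof
  assume "carrier R = UNIV"
  then have "(\<lambda>n. {}) \<in> carrier R" by simp
  then show False using class_nonempty[of "{}" 0] component_closed[of "\<lambda>n. {}" 0] by simp
qed

section \<open>The commutator pairing\<close>

text \<open>
  The identification \<open>H\<^sup>0(G, K) = K\<close>.
\<close>

definition aug where "aug A = (SOME f. f \<in> A) []"

text \<open>
  A \<open>2\<close>-cocycle describes a central extension of \<open>G\<close> by \<open>K\<close>, and for commuting \<open>a\<close>, \<open>b\<close> the value below is
  the commutator of lifts of \<open>a\<close> and \<open>b\<close>. This is why it depends only on the cohomology class.
\<close>

definition commutator where
  "commutator a b A = (let f = SOME f. f \<in> A in f [a, b] \<ominus>\<^bsub>K\<^esub> f [b, a])"

lemma cocycle_closed_0: "f \<in> carrier (Z 0) \<Longrightarrow> f [] \<in> carrier K"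
  using cochain_closed[of f 0 "[]"] by (simp add: mem_cocycle)

lemma cochain_closed_2:
  "f \<in> carrier (C 2) \<Longrightarrow> a \<in> carrier G \<Longrightarrow> b \<in> carrier G \<Longrightarrow> f [a, b] \<in> carrier K"
  using cochain_closed[of f 2 "[a, b]"] by simp

lemma cocycle_closed_2:
  "f \<in> carrier (Z 2) \<Longrightarrow> a \<in> carrier G \<Longrightarrow> b \<in> carrier G \<Longrightarrow> f [a, b] \<in> carrier K"
  using cochain_closed_2 by (simp add: mem_cocycle)

lemma aug_eq: "A \<in> carrier (HH 0) \<Longrightarrow> f \<in> A \<Longrightarrow> aug A = f []"
  unfolding aug_def using low_degree_unique[of 0 A] by (metis zero_le_one someI)

lemma aug_closed: "A \<in> carrier (HH 0) \<Longrightarrow> aug A \<in> carrier K"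
  using class_nonempty[of A 0] aug_eq[of A] representative(1)[of A 0] cocycle_closed_0 by metis

lemma coboundary_symmetric:
  assumes "f \<in> B 2" "a \<in> carrier G" "b \<in> carrier G" "a \<otimes>\<^bsub>G\<^esub> b = b \<otimes>\<^bsub>G\<^esub> a"
  shows "f [a, b] = f [b, a]"
proof -
  obtain u where u: "u \<in> carrier (C 1)" "f = d 1 u"
    using assms(1) by (auto simp: coboundaries_def numeral_2_eq_2)
  have c: "u [x] \<in> carrier K" if "x \<in> carrier G" for x
    using cochain_closed[OF u(1), of "[x]"] that by (simp add: tuples_def)
  show ?thesis
    unfolding u(2) coboundary_1[OF u(1) assms(2,3)] coboundary_1[OF u(1) assms(3,2)] assms(4)
    using c assms(2,3) by (simp add: a_minus_def K.a_ac)
qed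

lemma commutator_eq:
  assumes A: "A \<in> carrier (HH 2)" "f \<in> A"
    and ab: "a \<in> carrier G" "b \<in> carrier G" "a \<otimes>\<^bsub>G\<^esub> b = b \<otimes>\<^bsub>G\<^esub> a"
  shows "commutator a b A = f [a, b] \<ominus>\<^bsub>K\<^esub> f [b, a]"
proof -
  define g where "g = (SOME f. f \<in> A)"
  have "g \<in> A" unfolding g_def by (rule someI[of "\<lambda>f. f \<in> A", OF A(2)])
  then obtain h where h: "h \<in> B 2" "g = h \<otimes>\<^bsub>C 2\<^esub> f"
    using representative(2)[OF A] by (auto simp: mem_class)
  have f: "f \<in> carrier (Z 2)" using representative(1)[OF A] .
  have hZ: "h \<in> carrier (Z 2)" using h(1) coboundaries_subset by blast
  have k: "f [a, b] \<in> carrier K" "f [b, a] \<in> carrier K" "h [b, a] \<in> carrier K"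
    using f hZ ab cocycle_closed_2 by blast+
  have "commutator a b A = (h [b, a] \<oplus>\<^bsub>K\<^esub> f [a, b]) \<ominus>\<^bsub>K\<^esub> (h [b, a] \<oplus>\<^bsub>K\<^esub> f [b, a])"
    using ab coboundary_symmetric[OF h(1) ab]
    by (simp add: commutator_def flip: g_def) (simp add: h(2) mult_cochain)
  also have "\<dots> = f [a, b] \<ominus>\<^bsub>K\<^esub> f [b, a]"
    using k by (simp add: a_minus_def K.minus_add K.a_comm[of "h [b, a]" "f [a, b]"] K.a_assoc K.r_neg2)
  finally show ?thesis .
qed

context
  fixes a b :: 'a
  assumes ab: "a \<in> carrier G" "b \<in> carrier G" "a \<otimes>\<^bsub>G\<^esub> b = b \<otimes>\<^bsub>G\<^esub> a"
begin

lemma commutator_class: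
  "f \<in> carrier (Z 2) \<Longrightarrow> commutator a b (cls 2 f) = f [a, b] \<ominus>\<^bsub>K\<^esub> f [b, a]"
  by (rule commutator_eq[OF class_closed class_self ab])

lemma commutator_closed: "A \<in> carrier (HH 2) \<Longrightarrow> commutator a b A \<in> carrier K"
  using ab by (auto simp: mem_cohomology commutator_class cocycle_closed_2)

lemma commutator_coboundaries: "commutator a b (B 2) = \<zero>\<^bsub>K\<^esub>"
proof -
  interpret C: comm_group "C 2" by (rule group_cochain)
  have "\<one>\<^bsub>C 2\<^esub> \<in> B 2" using subgroup.one_closed[OF subgroup_coboundaries] .
  then show ?thesis
    using commutator_class[of "\<one>\<^bsub>C 2\<^esub>"] class_coboundary coboundaries_subset[of 2] ab
    by (auto simp: one_cochain K.r_right_minus_eq)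
qed

lemma commutator_add:
  assumes "A \<in> carrier (HH 2)" "A' \<in> carrier (HH 2)"
  shows "commutator a b (A \<otimes>\<^bsub>HH 2\<^esub> A') = commutator a b A \<oplus>\<^bsub>K\<^esub> commutator a b A'"
proof -
  interpret H: comm_group "HH 2" by (rule comm_group_cohomology)
  obtain f g where f: "f \<in> A" and g: "g \<in> A'" using assms class_nonempty by blast
  have fZ: "f \<in> carrier (Z 2)" "g \<in> carrier (Z 2)" using representative assms f g by blast+
  have "f \<otimes>\<^bsub>C 2\<^esub> g \<in> A \<otimes>\<^bsub>HH 2\<^esub> A'"
    using f g by (auto simp: cohomology_group_def set_mult_def)
  from commutator_eq[OF H.m_closed[OF assms] this ab]
  have "commutator a b (A \<otimes>\<^bsub>HH 2\<^esub> A') =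
      (f [a, b] \<oplus>\<^bsub>K\<^esub> g [a, b]) \<ominus>\<^bsub>K\<^esub> (f [b, a] \<oplus>\<^bsub>K\<^esub> g [b, a])"
    using ab by (simp add: mult_cochain)
  also have "\<dots> = (f [a, b] \<ominus>\<^bsub>K\<^esub> f [b, a]) \<oplus>\<^bsub>K\<^esub> (g [a, b] \<ominus>\<^bsub>K\<^esub> g [b, a])"
    using ab fZ by (simp add: a_minus_def K.minus_add K.a_ac cocycle_closed_2)
  finally show ?thesis
    using commutator_eq[OF assms(1) f ab] commutator_eq[OF assms(2) g ab] by simp
qed

lemma commutator_scale:
  assumes "c \<in> carrier K" "f \<in> A" "A \<in> carrier (HH 2)"
  shows "commutator a b (cls 2 (scale 2 c f)) = c \<otimes>\<^bsub>K\<^esub> commutator a b A"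
proof -
  have f: "f \<in> carrier (Z 2)" using representative assms by blast
  show ?thesis
    unfolding commutator_class[OF scale_cocycle[OF assms(1) f]] commutator_eq[OF assms(3,2) ab]
    using ab f assms(1)
    by (simp add: scale_def cocycle_closed_2 K.r_distr a_minus_def K.r_minus)
qed

text \<open>
  Together with \<open>aug_ring_mult\<close> this says that \<open>a \<mapsto> aug (a 0) + \<epsilon> commutator (a 2)\<close> is multiplicative with
  values in the dual numbers \<open>K[\<epsilon>]\<close>. The products \<open>H\<^sup>1 \<union> H\<^sup>1\<close> do not contribute because each summand of
  their commutator contains the value of a \<open>1\<close>-cocycle at \<open>b\<close>.
\<close>

lemma commutator_ring_mult:
  assumes b: "\<And>f. f \<in> carrier (Z 1) \<Longrightarrow> f [b] = \<zero>\<^bsub>K\<^esub>"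
    and x: "x \<in> carrier R" and y: "y \<in> carrier R"
  shows "commutator a b ((x \<otimes>\<^bsub>R\<^esub> y) 2) =
    aug (x 0) \<otimes>\<^bsub>K\<^esub> commutator a b (y 2) \<oplus>\<^bsub>K\<^esub> aug (y 0) \<otimes>\<^bsub>K\<^esub> commutator a b (x 2)"
proof -
  interpret H: comm_group "HH 2" by (rule comm_group_cohomology)
  note cl = component_closed[OF x] component_closed[OF y]
  obtain x0 x1 x2 y0 y1 y2
    where f: "x0 \<in> x 0" "x1 \<in> x 1" "x2 \<in> x 2" "y0 \<in> y 0" "y1 \<in> y 1" "y2 \<in> y 2"
    using cl class_nonempty by metis
  have aug: "aug (x 0) = x0 []" "aug (y 0) = y0 []" "x0 [] \<in> carrier K" "y0 [] \<in> carrier K"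
    using f cl aug_eq representative(1) cocycle_closed_0 by blast+
  have f1: "x1 \<in> carrier (Z 1)" "y1 \<in> carrier (Z 1)" using f cl representative(1) by blast+
  then have k1: "x1 [a] \<in> carrier K" "y1 [a] \<in> carrier K"
    using cochain_closed[of _ 1 "[a]"] ab by (auto simp: mem_cocycle tuples_def)
  have p0: "cup_class G K 0 2 (x 0) (y 2) = cls 2 (scale 2 (x0 []) y2)"
      "scale 2 (x0 []) y2 \<in> carrier (Z 2)"
    using cup_class_0_left[OF cl(1,2) f(1,6)] .
  have p2: "cup_class G K 2 0 (x 2) (y 0) = cls 2 (scale 2 (y0 []) x2)"
      "scale 2 (y0 []) x2 \<in> carrier (Z 2)"
    using cup_class_0_right[OF cl(1,2) f(3,4)] .
  have p1: "cup_class G K 1 1 (x 1) (y 1) = cls 2 (cup_cochain G K 1 1 x1 y1)"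
      "cup_cochain G K 1 1 x1 y1 \<in> carrier (Z 2)"
    using cup_class_1_1[OF cl(1,2) f(2,5)] cup_cochain_1_1_cocycle[OF f1] .
  have eq: "{..2::nat} = {0, 1, 2}" by auto
  have prod3: "finprod (HH 2) h {0, 1, 2} = h 0 \<otimes>\<^bsub>HH 2\<^esub> (h 1 \<otimes>\<^bsub>HH 2\<^esub> h 2)"
    if "h 0 \<in> carrier (HH 2)" "h 1 \<in> carrier (HH 2)" "h 2 \<in> carrier (HH 2)" for h :: "nat \<Rightarrow> _"
    using that by (simp del: one_cohomology)
  have "(x \<otimes>\<^bsub>R\<^esub> y) 2 = cup_class G K 0 2 (x 0) (y 2) \<otimes>\<^bsub>HH 2\<^esub>
      (cup_class G K 1 1 (x 1) (y 1) \<otimes>\<^bsub>HH 2\<^esub> cup_class G K 2 0 (x 2) (y 0))"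
    unfolding mult_R eq using p0 p1 p2 class_closed by (subst prod3) simp_all
  moreover have "commutator a b (cup_class G K 1 1 (x 1) (y 1)) = \<zero>\<^bsub>K\<^esub>"
    unfolding p1(1) commutator_class[OF p1(2)]
    using ab k1 b[OF f1(1)] b[OF f1(2)] by (simp add: cup_cochain_def tuples_def)
  moreover have "commutator a b (cup_class G K 0 2 (x 0) (y 2)) = aug (x 0) \<otimes>\<^bsub>K\<^esub> commutator a b (y 2)"
    unfolding p0(1) aug(1) by (rule commutator_scale[OF aug(3) f(6) cl(2)])
  moreover have "commutator a b (cup_class G K 2 0 (x 2) (y 0)) = aug (y 0) \<otimes>\<^bsub>K\<^esub> commutator a b (x 2)"
    unfolding p2(1) aug(2) by (rule commutator_scale[OF aug(4) f(3) cl(1)])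
  ultimately show ?thesis
    using p0 p1 p2 class_closed[of _ 2] aug_closed[OF cl(1)] aug_closed[OF cl(2)]
      commutator_closed[OF cl(1)] commutator_closed[OF cl(2)]
    by (simp add: commutator_add)
qed

end

lemma aug_ring_mult:
  assumes x: "x \<in> carrier R" and y: "y \<in> carrier R"
  shows "aug ((x \<otimes>\<^bsub>R\<^esub> y) 0) = aug (x 0) \<otimes>\<^bsub>K\<^esub> aug (y 0)"
proof -
  interpret H: comm_group "HH 0" by (rule comm_group_cohomology)
  note cl = component_closed[OF x, of 0] component_closed[OF y, of 0]
  obtain f g where f: "f \<in> x 0" "g \<in> y 0"
    using cl class_nonempty by metis
  note p = cup_class_0_left[OF cl f]
  have "(x \<otimes>\<^bsub>R\<^esub> y) 0 = cls 0 (scale 0 (f []) g)"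
    unfolding mult_R using p class_closed[OF p(2)] by (simp del: one_cohomology)
  then show ?thesis
    using aug_eq[OF class_closed[OF p(2)] class_self[OF p(2)]] aug_eq[OF cl(1) f(1)] aug_eq[OF cl(2) f(2)]
    by (simp add: scale_def)
qed

lemma aug_ring_add:
  assumes x: "x \<in> carrier R" and y: "y \<in> carrier R"
  shows "aug ((x \<oplus>\<^bsub>R\<^esub> y) 0) = aug (x 0) \<oplus>\<^bsub>K\<^esub> aug (y 0)"
proof -
  interpret H: comm_group "HH 0" by (rule comm_group_cohomology)
  note cl = component_closed[OF x, of 0] component_closed[OF y, of 0]
  obtain f g where f: "f \<in> x 0" "g \<in> y 0"
    using cl class_nonempty by metis
  then have "f \<otimes>\<^bsub>C 0\<^esub> g \<in> x 0 \<otimes>\<^bsub>HH 0\<^esub> y 0"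
    by (auto simp: cohomology_group_def set_mult_def)
  from aug_eq[OF H.m_closed[OF cl] this]
  show ?thesis
    using aug_eq[OF cl(1) f(1)] aug_eq[OF cl(2) f(2)] by (simp add: add_R mult_cochain)
qed

lemma aug_coboundaries: "aug (B 0) = \<zero>\<^bsub>K\<^esub>"
  by (simp add: aug_def coboundaries_0 one_cochain)

text \<open>
  Over a finite ring a finitely generated module is finite.
\<close>

lemma finite_span:
  fixes v :: "'s \<Rightarrow> 'i \<Rightarrow> 'k"
  assumes S: "finite S" and fin: "finite (carrier K)"
    and v: "\<And>s i. s \<in> S \<Longrightarrow> v s i \<in> carrier K"
  shows "\<exists>W. finite W \<and> v ` S \<subseteq> W \<and> (\<lambda>i. \<zero>\<^bsub>K\<^esub>) \<in> W \<and>
    (\<forall>w\<in>W. \<forall>w'\<in>W. (\<lambda>i. w i \<oplus>\<^bsub>K\<^esub> w' i) \<in> W) \<and>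
    (\<forall>c\<in>carrier K. \<forall>w\<in>W. (\<lambda>i. c \<otimes>\<^bsub>K\<^esub> w i) \<in> W)"
proof -
  define L where "L c = (\<lambda>i. \<Oplus>\<^bsub>K\<^esub>s\<in>S. c s \<otimes>\<^bsub>K\<^esub> v s i)" for c
  define W where "W = L ` (S \<rightarrow>\<^sub>E carrier K)"
  have L: "L c \<in> W" if "c \<in> S \<rightarrow> carrier K" for c
  proof -
    have "L c = L (restrict c S)"
      unfolding L_def by (intro ext K.finsum_cong') (use that v in \<open>auto simp: Pi_iff\<close>)
    then show ?thesis using that by (auto simp: W_def)
  qed
  show ?thesis
  proof (intro exI[of _ W] conjI ballI)
    show "finite W" unfolding W_def using S fin by (simp add: finite_PiE)
    show "v ` S \<subseteq> W"
    proof
      fix w assume "w \<in> v ` S"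
      then obtain s where s: "s \<in> S" "w = v s" by auto
      have "L (\<lambda>t. if s = t then \<one>\<^bsub>K\<^esub> else \<zero>\<^bsub>K\<^esub>) i = v s i" for i
      proof -
        have "L (\<lambda>t. if s = t then \<one>\<^bsub>K\<^esub> else \<zero>\<^bsub>K\<^esub>) i = (\<Oplus>\<^bsub>K\<^esub>t\<in>S. if s = t then v t i else \<zero>\<^bsub>K\<^esub>)"
          unfolding L_def by (rule K.finsum_cong') (use v in auto)
        also have "\<dots> = v s i" by (rule K.finsum_singleton) (use s S v in auto)
        finally show ?thesis .
      qed
      then have "w = L (\<lambda>t. if s = t then \<one>\<^bsub>K\<^esub> else \<zero>\<^bsub>K\<^esub>)" using s by auto
      also have "\<dots> \<in> W" by (rule L) auto
      finally show "w \<in> W" .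
    qed
    have "L (\<lambda>s. \<zero>\<^bsub>K\<^esub>) \<in> W" by (rule L) auto
    moreover have "L (\<lambda>s. \<zero>\<^bsub>K\<^esub>) i = \<zero>\<^bsub>K\<^esub>" for i
    proof -
      have "L (\<lambda>s. \<zero>\<^bsub>K\<^esub>) i = (\<Oplus>\<^bsub>K\<^esub>s\<in>S. \<zero>\<^bsub>K\<^esub>)"
        unfolding L_def by (rule K.finsum_cong') (use v in auto)
      then show ?thesis by simp
    qed
    ultimately show "(\<lambda>i. \<zero>\<^bsub>K\<^esub>) \<in> W" by (metis ext)
  next
    fix w w' assume "w \<in> W" "w' \<in> W"
    then obtain c c' where c: "c \<in> S \<rightarrow> carrier K" "w = L c" "c' \<in> S \<rightarrow> carrier K" "w' = L c'"
      by (auto simp: W_def PiE_def)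
    have "(\<lambda>i. w i \<oplus>\<^bsub>K\<^esub> w' i) = L (\<lambda>s. c s \<oplus>\<^bsub>K\<^esub> c' s)"
    proof
      fix i
      have "L (\<lambda>s. c s \<oplus>\<^bsub>K\<^esub> c' s) i = (\<Oplus>\<^bsub>K\<^esub>s\<in>S. c s \<otimes>\<^bsub>K\<^esub> v s i \<oplus>\<^bsub>K\<^esub> c' s \<otimes>\<^bsub>K\<^esub> v s i)"
        unfolding L_def by (rule K.finsum_cong') (use v c in \<open>auto simp: Pi_iff K.l_distr\<close>)
      also have "\<dots> = w i \<oplus>\<^bsub>K\<^esub> w' i"
        unfolding c(2,4) L_def by (rule K.finsum_addf) (use v c in \<open>auto simp: Pi_iff\<close>)
      finally show "w i \<oplus>\<^bsub>K\<^esub> w' i = L (\<lambda>s. c s \<oplus>\<^bsub>K\<^esub> c' s) i" by simp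
    qed
    moreover have "L (\<lambda>s. c s \<oplus>\<^bsub>K\<^esub> c' s) \<in> W" by (rule L) (use c in \<open>auto simp: Pi_iff\<close>)
    ultimately show "(\<lambda>i. w i \<oplus>\<^bsub>K\<^esub> w' i) \<in> W" by simp
  next
    fix k w assume k: "k \<in> carrier K" and "w \<in> W"
    then obtain c where c: "c \<in> S \<rightarrow> carrier K" "w = L c"
      by (auto simp: W_def PiE_def)
    have "(\<lambda>i. k \<otimes>\<^bsub>K\<^esub> w i) = L (\<lambda>s. k \<otimes>\<^bsub>K\<^esub> c s)"
    proof
      fix i
      have "k \<otimes>\<^bsub>K\<^esub> w i = (\<Oplus>\<^bsub>K\<^esub>s\<in>S. k \<otimes>\<^bsub>K\<^esub> (c s \<otimes>\<^bsub>K\<^esub> v s i))"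
        unfolding c(2) L_def by (rule K.finsum_rdistr) (use S k v c in \<open>auto simp: Pi_iff\<close>)
      also have "\<dots> = L (\<lambda>s. k \<otimes>\<^bsub>K\<^esub> c s) i"
        unfolding L_def by (rule K.finsum_cong') (use k v c in \<open>auto simp: Pi_iff K.m_assoc\<close>)
      finally show "k \<otimes>\<^bsub>K\<^esub> w i = L (\<lambda>s. k \<otimes>\<^bsub>K\<^esub> c s) i" .
    qed
    moreover have "L (\<lambda>s. k \<otimes>\<^bsub>K\<^esub> c s) \<in> W" by (rule L) (use k c in \<open>auto simp: Pi_iff\<close>)
    ultimately show "(\<lambda>i. k \<otimes>\<^bsub>K\<^esub> w i) \<in> W" by simp
  qed
qed

text \<open>
  The commutators with the elements \<open>x i\<close> turn a class into a vector in \<open>K\<^sup>\<nat>\<close>. The vector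
  is additive, and for elements without component in degree \<open>0\<close> multiplication by any ring element
  only scales it. Hence the vectors that occur in an ideal of such elements generated by a finite set \<open>S\<close>
  lie in the span of the vectors of \<open>S\<close>, which is finite when \<open>K\<close> is.
\<close>

theorem not_finitely_generated_by_commutators:
  fixes x :: "nat \<Rightarrow> 'a" and e :: "nat \<Rightarrow> nat \<Rightarrow> ('a list \<Rightarrow> 'k) set"
  assumes fin: "finite (carrier K)"
    and s: "s \<in> carrier G" and x: "\<And>i. x i \<in> carrier G"
    and comm: "\<And>i. s \<otimes>\<^bsub>G\<^esub> x i = x i \<otimes>\<^bsub>G\<^esub> s"
    and kill: "\<And>i f. f \<in> carrier (Z 1) \<Longrightarrow> f [x i] = \<zero>\<^bsub>K\<^esub>"
    and I: "I \<subseteq> carrier R" "\<And>u. u \<in> I \<Longrightarrow> aug (u 0) = \<zero>\<^bsub>K\<^esub>"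
    and e: "\<And>j. e j \<in> I" "inj (\<lambda>j i. commutator s (x i) (e j 2))"
  shows "\<not> finitely_generated_ideal R I"
proof
  assume "finitely_generated_ideal R I"
  then obtain S where S: "S \<subseteq> carrier R" "finite S" and idl: "I = Idl\<^bsub>R\<^esub> S"
    by (auto simp: finitely_generated_ideal_def)
  \<comment> \<open>\<^term>\<open>Idl\<^bsub>R\<^esub> S\<close> is an intersection of ideals. As it is not the whole type, the family is not empty,
    and an ideal exists only in a structure that satisfies the ring axioms.\<close>
  have ex: "\<exists>J. ideal J R \<and> S \<subseteq> J"
  proof (rule ccontr)
    assume "\<not> ?thesis"
    then have "Idl\<^bsub>R\<^esub> S = UNIV" by (auto simp: genideal_def)
    then show False using I(1) idl carrier_R_proper by blast
  qed
  then have ring: "ring R" by (auto dest: ideal.axioms(2))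
  interpret R: ring R by (rule ring)
  have SI: "S \<subseteq> I" unfolding idl by (rule R.genideal_self[OF S(1)])
  define v where "v u = (\<lambda>i. commutator s (x i) (u 2))" for u :: "nat \<Rightarrow> ('a list \<Rightarrow> 'k) set"
  have v: "v u i \<in> carrier K" if "u \<in> carrier R" for u i
    unfolding v_def using commutator_closed[OF s x comm component_closed[OF that]] .
  have v_add: "v (u \<oplus>\<^bsub>R\<^esub> u') = (\<lambda>i. v u i \<oplus>\<^bsub>K\<^esub> v u' i)"
    if "u \<in> carrier R" "u' \<in> carrier R" for u u'
    unfolding v_def add_R using commutator_add[OF s x comm] that component_closed by presburger
  have v_mult: "v (u \<otimes>\<^bsub>R\<^esub> u') = (\<lambda>i. aug (u 0) \<otimes>\<^bsub>K\<^esub> v u' i \<oplus>\<^bsub>K\<^esub> aug (u' 0) \<otimes>\<^bsub>K\<^esub> v u i)"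
    if "u \<in> carrier R" "u' \<in> carrier R" for u u'
    unfolding v_def by (intro ext commutator_ring_mult[OF s x comm]) (use kill that in auto)
  have vS: "v u i \<in> carrier K" if "u \<in> S" for u i using S(1) v that by blast
  obtain W where W: "finite W" "v ` S \<subseteq> W" "(\<lambda>i. \<zero>\<^bsub>K\<^esub>) \<in> W"
    "\<forall>w\<in>W. \<forall>w'\<in>W. (\<lambda>i. w i \<oplus>\<^bsub>K\<^esub> w' i) \<in> W"
    "\<forall>c\<in>carrier K. \<forall>w\<in>W. (\<lambda>i. c \<otimes>\<^bsub>K\<^esub> w i) \<in> W"
    using finite_span[OF S(2) fin, of v] vS by blast
  define J where "J = {u \<in> carrier R. aug (u 0) = \<zero>\<^bsub>K\<^esub> \<and> v u \<in> W}"
  have J_l: "r \<otimes>\<^bsub>R\<^esub> u \<in> J" if u: "u \<in> J" and r: "r \<in> carrier R" for u r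
  proof -
    have uc: "u \<in> carrier R" "aug (u 0) = \<zero>\<^bsub>K\<^esub>" "v u \<in> W" using u by (auto simp: J_def)
    have "v (r \<otimes>\<^bsub>R\<^esub> u) = (\<lambda>i. aug (r 0) \<otimes>\<^bsub>K\<^esub> v u i)"
      using v_mult[OF r uc(1)] uc(2) v[OF r] v[OF uc(1)] aug_closed[OF component_closed[OF r]] by simp
    then show ?thesis
      using W(5) uc r
        aug_closed[OF component_closed[OF r]]
      by (simp add: J_def aug_ring_mult)
  qed
  have J_r: "u \<otimes>\<^bsub>R\<^esub> r \<in> J" if u: "u \<in> J" and r: "r \<in> carrier R" for u r
  proof -
    have uc: "u \<in> carrier R" "aug (u 0) = \<zero>\<^bsub>K\<^esub>" "v u \<in> W" using u by (auto simp: J_def)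
    have "v (u \<otimes>\<^bsub>R\<^esub> r) = (\<lambda>i. aug (r 0) \<otimes>\<^bsub>K\<^esub> v u i)"
      using v_mult[OF uc(1) r] uc(2) v[OF r] v[OF uc(1)] aug_closed[OF component_closed[OF r]] by simp
    then show ?thesis
      using W(5) uc r
        aug_closed[OF component_closed[OF r]]
      by (simp add: J_def aug_ring_mult)
  qed
  have "ideal J R"
  proof (rule idealI[OF ring])
    show "subgroup J (add_monoid R)"
    proof (rule group.subgroupI[OF R.a_group])
      show "J \<subseteq> carrier (add_monoid R)" by (auto simp: J_def)
      have "v \<zero>\<^bsub>R\<^esub> = (\<lambda>i. \<zero>\<^bsub>K\<^esub>)"
        unfolding v_def zero_R using commutator_coboundaries[OF s x comm] by blast
      then have "\<zero>\<^bsub>R\<^esub> \<in> J" using W(3) by (simp add: J_def zero_R aug_coboundaries)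
      then show "J \<noteq> {}" by blast
    next
      fix u assume u: "u \<in> J"
      then have "\<ominus>\<^bsub>R\<^esub> u = (\<ominus>\<^bsub>R\<^esub> \<one>\<^bsub>R\<^esub>) \<otimes>\<^bsub>R\<^esub> u" by (simp add: J_def R.l_minus)
      then have "\<ominus>\<^bsub>R\<^esub> u \<in> J"
        using J_l[OF u, of "\<ominus>\<^bsub>R\<^esub> \<one>\<^bsub>R\<^esub>"] by simp
      then show "inv\<^bsub>add_monoid R\<^esub> u \<in> J" by (simp add: a_inv_def)
    next
      fix u u' assume "u \<in> J" "u' \<in> J"
      then show "u \<otimes>\<^bsub>add_monoid R\<^esub> u' \<in> J"
        using W(4) by (simp add: J_def aug_ring_add v_add)
    qed
  qed (use J_l J_r in auto)
  moreover have "S \<subseteq> J" using S(1) SI I(2) W(2) by (auto simp: J_def)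
  ultimately have "I \<subseteq> J" unfolding idl by (rule R.genideal_minimal)
  then have "range (\<lambda>j. v (e j)) \<subseteq> W" using e(1) by (auto simp: J_def)
  then have "finite (range (\<lambda>j. v (e j)))" using W(1) finite_subset by blast
  moreover have "inj (\<lambda>j. v (e j))" using e(2) by (simp add: v_def)
  ultimately show False using finite_imageD by blast
qed

end

section \<open>Functoriality\<close>

locale bar_complex_hom = G: bar_complex G K + H: bar_complex H K
  for G :: "('a, 'm) monoid_scheme" and K :: "('k, 'r) ring_scheme"
    and H :: "('b, 'n) monoid_scheme" +
  fixes \<phi> :: "'b \<Rightarrow> 'a"
  assumes hom: "\<phi> \<in> hom H G"
begin

definition pullback where "pullback n f = (\<lambda>xs\<in>tuples H n. f (map \<phi> xs))"

lemma map_tuples: "xs \<in> tuples H n \<Longrightarrow> map \<phi> xs \<in> tuples G n"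
  using hom by (auto simp: tuples_def hom_def)

lemma pullback_closed:
  "f \<in> carrier (cochain_group G K n) \<Longrightarrow> pullback n f \<in> carrier (cochain_group H K n)"
  using map_tuples by (auto simp: G.mem_cochain H.mem_cochain pullback_def)

lemma face_map:
  assumes "xs \<in> tuples H (Suc n)" "i \<le> Suc n"
  shows "map \<phi> (H.face i xs) = G.face i (map \<phi> xs)"
proof (rule nth_equalityI)
  note t = H.face_closed[OF assms] G.face_closed[OF map_tuples[OF assms(1)] assms(2)]
  show "length (map \<phi> (H.face i xs)) = length (G.face i (map \<phi> xs))"
    using t by (simp add: tuples_def)
  fix r assume "r < length (map \<phi> (H.face i xs))"
  then have r: "r < n" using t by (simp add: tuples_def)
  have l: "length xs = Suc n" "length (H.face i xs) = n" using t assms(1) by (auto simp: tuples_def)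
  have "xs ! r \<in> carrier H" "xs ! Suc r \<in> carrier H"
    using H.nth_closed[OF assms(1)] r by auto
  then have "\<phi> (xs ! r \<otimes>\<^bsub>H\<^esub> xs ! Suc r) = \<phi> (xs ! r) \<otimes>\<^bsub>G\<^esub> \<phi> (xs ! Suc r)"
    using hom by (simp add: hom_def)
  then show "map \<phi> (H.face i xs) ! r = G.face i (map \<phi> xs) ! r"
    using r l assms(2) by (cases "i = Suc r") (simp_all add: H.nth_face G.nth_face)
qed

lemma pullback_coboundary_map:
  assumes f: "f \<in> carrier (cochain_group G K n)"
  shows "pullback (Suc n) (coboundary_map G K n f) = coboundary_map H K n (pullback n f)"
proof (rule H.cochain_eqI)
  show "pullback (Suc n) (coboundary_map G K n f) \<in> carrier (cochain_group H K (Suc n))"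
    "coboundary_map H K n (pullback n f) \<in> carrier (cochain_group H K (Suc n))"
    using f by (simp_all add: pullback_closed G.coboundary_closed H.coboundary_closed)
  fix xs assume xs: "xs \<in> tuples H (Suc n)"
  have "coboundary_map G K n f (map \<phi> xs) = coboundary_map H K n (pullback n f) xs"
    unfolding G.coboundary_faces[OF f map_tuples[OF xs]] H.coboundary_faces[OF pullback_closed[OF f] xs]
  proof (rule G.K.finsum_cong')
    show "(\<lambda>i. G.sgn i \<otimes>\<^bsub>K\<^esub> pullback n f (H.face i xs)) \<in> {..Suc n} \<rightarrow> carrier K"
      using H.cochain_closed[OF pullback_closed[OF f]] xs by auto
    fix i assume "i \<in> {..Suc n}"
    then show "G.sgn i \<otimes>\<^bsub>K\<^esub> f (G.face i (map \<phi> xs)) = G.sgn i \<otimes>\<^bsub>K\<^esub> pullback n f (H.face i xs)"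
      using xs face_map[OF xs] H.face_closed[OF xs] by (simp add: pullback_def)
  qed simp
  then show "pullback (Suc n) (coboundary_map G K n f) xs = coboundary_map H K n (pullback n f) xs"
    using xs by (simp add: pullback_def)
qed

lemma pullback_coboundary: "f \<in> coboundaries G K n \<Longrightarrow> pullback n f \<in> coboundaries H K n"
proof (cases n)
  case 0
  then show "f \<in> coboundaries G K n \<Longrightarrow> ?thesis"
    by (auto simp: coboundaries_def pullback_def G.one_cochain H.one_cochain)
next
  case (Suc m)
  assume "f \<in> coboundaries G K n"
  then obtain u where "u \<in> carrier (cochain_group G K m)" "f = coboundary_map G K m u"
    by (auto simp: coboundaries_def Suc)
  then show ?thesis
    using pullback_coboundary_map[of u m] pullback_closed[of u m] by (auto simp: coboundaries_def Suc)
qed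

lemma cohomology_map_component:
  "a \<in> carrier G.R \<Longrightarrow>
    cohomology_map H G K \<phi> a n = (\<Union>f\<in>a n. cohomology_class H K n (pullback n f))"
  by (simp add: cohomology_map_def pullback_def)

lemma mem_kernel_cohomology_map:
  "a \<in> a_kernel G.R H.R (cohomology_map H G K \<phi>) \<longleftrightarrow>
    a \<in> carrier G.R \<and> (\<forall>n. (\<Union>f\<in>a n. cohomology_class H K n (pullback n f)) = coboundaries H K n)"
  by (simp add: a_kernel_def kernel_def cohomology_map_component H.zero_R fun_eq_iff cong: conj_cong)

text \<open>
  \<open>\<phi>\<close> induces the identity of \<open>K\<close> in degree \<open>0\<close>, so kernels have no component there.
\<close>

lemma aug_kernel_cohomology_map:
  assumes "a \<in> a_kernel G.R H.R (cohomology_map H G K \<phi>)"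
  shows "G.aug (a 0) = \<zero>\<^bsub>K\<^esub>"
proof -
  interpret C: comm_group "cochain_group H K 0" by (rule H.group_cochain)
  have a: "a \<in> carrier G.R" and
    ker: "(\<Union>f\<in>a 0. cohomology_class H K 0 (pullback 0 f)) = coboundaries H K 0"
    using assms by (auto simp: mem_kernel_cohomology_map)
  obtain f where f: "f \<in> a 0" using G.class_nonempty[OF G.component_closed[OF a]] by blast
  have fc: "f \<in> carrier (cochain_group G K 0)"
    using G.representative(1)[OF G.component_closed[OF a] f] by (simp add: G.mem_cocycle)
  then have "pullback 0 f \<in> cohomology_class H K 0 (pullback 0 f)"
    using pullback_closed[OF fc] by (auto simp: H.mem_class H.coboundaries_0)
  then have "pullback 0 f = \<one>\<^bsub>cochain_group H K 0\<^esub>"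
    using ker f by (auto simp: H.coboundaries_0)
  then have "pullback 0 f [] = \<zero>\<^bsub>K\<^esub>" by (simp add: H.one_cochain)
  then show ?thesis
    using G.aug_eq[OF G.component_closed[OF a] f] by (simp add: pullback_def)
qed

lemma class_in_kernel:
  assumes f: "f \<in> carrier (cocycle_group G K n)" and res: "pullback n f \<in> coboundaries H K n"
  shows "(\<lambda>m. if m = n then cohomology_class G K n f else coboundaries G K m)
    \<in> a_kernel G.R H.R (cohomology_map H G K \<phi>)"
proof -
  have trivial: "cohomology_class H K m (pullback m g) = coboundaries H K m"
    if g: "g \<in> coboundaries G K m" for m g
    using H.class_coboundary[OF pullback_coboundary[OF g]] .
  have add: "pullback n (g \<otimes>\<^bsub>cochain_group G K n\<^esub> f) \<in> coboundaries H K n"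
    if g: "g \<in> coboundaries G K n" for g
  proof -
    have "pullback n (g \<otimes>\<^bsub>cochain_group G K n\<^esub> f) =
        pullback n g \<otimes>\<^bsub>cochain_group H K n\<^esub> pullback n f"
      using map_tuples by (auto simp: pullback_def cochain_group_def intro!: restrict_ext)
    then show ?thesis
      using subgroup.m_closed[OF H.subgroup_coboundaries pullback_coboundary[OF g] res] by simp
  qed
  have "(\<Union>g\<in>cohomology_class G K n f. cohomology_class H K n (pullback n g)) = coboundaries H K n"
  proof -
    have "cohomology_class H K n (pullback n g) = coboundaries H K n"
      if "g \<in> cohomology_class G K n f" for g
      using that H.class_coboundary[OF add] by (auto simp: G.mem_class)
    then show ?thesis using G.class_self[OF f] by blast
  qed
  moreover have "(\<Union>g\<in>coboundaries G K m. cohomology_class H K m (pullback m g)) = coboundaries H K m" for m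
    using trivial subgroup.one_closed[OF G.subgroup_coboundaries] by blast
  ultimately show ?thesis
    by (simp add: mem_kernel_cohomology_map G.homogeneous_mem_R[OF G.class_closed[OF f]])
qed

end

section \<open>The elementary abelian group and its shears\<close>

locale shear_group =
  fixes p :: nat
  assumes p_gt_1: "1 < p"
begin

abbreviation H where "H \<equiv> H_group p"
abbreviation G where "G \<equiv> G_group p"

lemma residues_p: "residues (int p)"
  using p_gt_1 by unfold_locales simp

lemma mem_V: "v \<in> carrier (V_group p) \<longleftrightarrow> fst v \<in> {0..<int p} \<and> snd v \<in> {0..<int p}"
  by (cases v) (auto simp: V_group_def residue_ring_def)

lemma mult_V: "v \<otimes>\<^bsub>V_group p\<^esub> w = ((fst v + fst w) mod int p, (snd v + snd w) mod int p)"
  by (cases v; cases w) (simp add: V_group_def residue_ring_def)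

lemma one_V: "\<one>\<^bsub>V_group p\<^esub> = (0, 0)"
  by (simp add: V_group_def residue_ring_def)

lemma group_V: "group (V_group p)"
  unfolding V_group_def
  using residues.abelian_group[OF residues_p]
  by (intro DirProd_group abelian_group.a_group)

lemma group_H: "group H"
  by (simp add: H_group_def group_V)

lemma mem_H: "h \<in> carrier H \<longleftrightarrow>
    (\<forall>i. fst (h i) \<in> {0..<int p} \<and> snd (h i) \<in> {0..<int p}) \<and> finite {i. h i \<noteq> (0, 0)}"
  by (auto simp: H_group_def carrier_sum_group group_V PiE_iff mem_V one_V)

lemma mult_H: "h \<otimes>\<^bsub>H\<^esub> k =
    (\<lambda>i. ((fst (h i) + fst (k i)) mod int p, (snd (h i) + snd (k i)) mod int p))"
  by (simp add: H_group_def mult_V fun_eq_iff)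

lemma one_H: "\<one>\<^bsub>H\<^esub> = (\<lambda>i. (0, 0))"
  by (simp add: H_group_def one_V fun_eq_iff)

lemma reduced:
  assumes "h \<in> carrier H"
  shows "fst (h i) mod int p = fst (h i)" "snd (h i) mod int p = snd (h i)"
  using assms by (auto simp: mem_H)

text \<open>
  The powers of \<open>\<sigma>\<close>. The exponent is an integer, which is reduced by the action itself; this avoids
  carrying representatives modulo \<open>p\<close> through the group law.
\<close>

definition shear where
  "shear a = (\<lambda>h\<in>carrier H. \<lambda>i. ((fst (h i) + a * snd (h i)) mod int p, snd (h i)))"

lemma shear_apply: "h \<in> carrier H \<Longrightarrow>
    shear a h = (\<lambda>i. ((fst (h i) + a * snd (h i)) mod int p, snd (h i)))"
  by (simp add: shear_def)

lemma shear_closed: 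
  assumes "h \<in> carrier H" shows "shear a h \<in> carrier H"
proof -
  have "{i. shear a h i \<noteq> (0, 0)} \<subseteq> {i. h i \<noteq> (0, 0)}"
    using assms by (auto simp: shear_apply)
  then have "finite {i. shear a h i \<noteq> (0, 0)}"
    using assms by (auto simp: mem_H intro: finite_subset)
  then show ?thesis
    using assms p_gt_1 by (auto simp: mem_H shear_apply)
qed

lemma shear_shear: "h \<in> carrier H \<Longrightarrow> shear a (shear b h) = shear (a + b) h"
  unfolding shear_apply[OF shear_closed] by (simp add: shear_apply fun_eq_iff mod_simps algebra_simps)

lemma shear_0: "h \<in> carrier H \<Longrightarrow> shear 0 h = h"
  by (simp add: shear_apply reduced)

lemma compose_shear: "compose (carrier H) (shear a) (shear b) = shear (a + b)"
proof
  fix h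
  show "compose (carrier H) (shear a) (shear b) h = shear (a + b) h"
    by (cases "h \<in> carrier H") (simp_all add: compose_def shear_shear, simp add: shear_def)
qed

lemma mod_add_mult_mod_right: "(u + a * (v mod q)) mod q = (u + a * v) mod q" for a u v q :: int
  by (metis mod_add_right_eq mod_mult_right_eq)

lemma shear_mult:
  "h \<in> carrier H \<Longrightarrow> k \<in> carrier H \<Longrightarrow> shear a (h \<otimes>\<^bsub>H\<^esub> k) = shear a h \<otimes>\<^bsub>H\<^esub> shear a k"
  using group.subgroup_self[OF group_H, THEN subgroup.m_closed, of h k]
  by (simp add: shear_apply fun_eq_iff) (simp add: mult_H mod_simps mod_add_mult_mod_right, simp add: algebra_simps)

lemma shear_auto: "shear a \<in> auto H"
proof -
  have "bij_betw (shear a) (carrier H) (carrier H)"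
    by (rule bij_betw_byWitness[of _ "shear (- a)"])
      (auto simp: shear_closed shear_shear shear_0)
  then show ?thesis
    using shear_closed shear_mult
    by (auto simp: auto_def hom_def Bij_def) (simp add: shear_def)
qed

lemma sigma_H_shear: "sigma_H p = shear 1"
  unfolding sigma_H_def shear_def
  by (intro restrict_ext ext) (simp add: sigma_V_def residue_ring_def split: prod.split)

lemma mult_Auto_shear: "shear a \<otimes>\<^bsub>AutoGroup H\<^esub> shear b = shear (a + b)"
  using shear_auto by (simp add: AutoGroup_def BijGroup_def auto_def compose_shear)

lemma one_Auto_shear: "\<one>\<^bsub>AutoGroup H\<^esub> = shear 0"
  unfolding AutoGroup_def BijGroup_def by (simp add: fun_eq_iff shear_0) (simp add: shear_def)

lemma carrier_AutoGroup: "carrier (AutoGroup H) = auto H"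
  by (simp add: AutoGroup_def)

lemma group_Auto: "group (AutoGroup H)"
  by (rule group.AutoGroup[OF group_H])

lemma subgroup_shears: "subgroup (range shear) (AutoGroup H)"
proof (rule group.subgroupI[OF group_Auto])
  show "range shear \<subseteq> carrier (AutoGroup H)"
    using shear_auto by (auto simp: carrier_AutoGroup)
  fix f g assume "f \<in> range shear" "g \<in> range shear"
  then obtain a b where ab: "f = shear a" "g = shear b" by auto
  have "inv\<^bsub>AutoGroup H\<^esub> (shear a) = shear (- a)"
    by (rule group.inv_equality[OF group_Auto])
      (simp_all add: mult_Auto_shear one_Auto_shear carrier_AutoGroup shear_auto)
  then show "inv\<^bsub>AutoGroup H\<^esub> f \<in> range shear" by (simp add: ab)
  show "f \<otimes>\<^bsub>AutoGroup H\<^esub> g \<in> range shear" by (simp add: ab mult_Auto_shear)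
qed auto

lemma sigma_group_shears: "carrier (sigma_group p) \<subseteq> range shear"
  unfolding sigma_group_def sigma_H_shear
  by (rule group.subgroup_generated_minimal[OF group_Auto subgroup_shears]) auto

lemma group_sigma: "group (sigma_group p)"
  unfolding sigma_group_def by (rule group.group_subgroup_generated[OF group_Auto])

lemma mult_sigma: "shear a \<otimes>\<^bsub>sigma_group p\<^esub> shear b = shear (a + b)"
  by (simp add: sigma_group_def mult_Auto_shear)

lemma one_sigma: "\<one>\<^bsub>sigma_group p\<^esub> = shear 0"
  by (simp add: sigma_group_def one_Auto_shear)

lemma shear_0_mem: "shear 0 \<in> carrier (sigma_group p)"
  using monoid.one_closed[OF group.is_monoid[OF group_sigma]] by (simp add: one_sigma)

lemma shear_1_mem: "shear 1 \<in> carrier (sigma_group p)"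
  unfolding sigma_group_def sigma_H_shear carrier_subgroup_generated
  by (rule generate.incl) (simp add: carrier_AutoGroup shear_auto)

section \<open>The semidirect product\<close>

lemma mem_G: "g \<in> carrier G \<longleftrightarrow> fst g \<in> carrier (sigma_group p) \<and> snd g \<in> carrier H"
  by (cases g) (simp add: G_group_def semidirect_product_def)

lemma mult_G: "(shear a, h) \<otimes>\<^bsub>G\<^esub> (shear b, k) = (shear (a + b), h \<otimes>\<^bsub>H\<^esub> shear a k)"
  by (simp add: G_group_def semidirect_product_def mult_sigma)

lemma one_G: "\<one>\<^bsub>G\<^esub> = (shear 0, \<one>\<^bsub>H\<^esub>)"
  by (simp add: G_group_def semidirect_product_def one_sigma)

lemma G_cases:
  assumes "g \<in> carrier G"
  obtains a h where "g = (shear a, h)" "shear a \<in> carrier (sigma_group p)" "h \<in> carrier H"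
  using assms sigma_group_shears by (cases g) (auto simp: mem_G)

lemma monoid_G: "monoid G"
proof
  interpret H: group H by (rule group_H)
  interpret S: group "sigma_group p" by (rule group_sigma)
  show "x \<otimes>\<^bsub>G\<^esub> y \<in> carrier G" if "x \<in> carrier G" "y \<in> carrier G" for x y
    using that
    by (elim G_cases) (simp add: mult_G, simp add: mem_G shear_closed S.m_closed flip: mult_sigma)
  show "x \<otimes>\<^bsub>G\<^esub> y \<otimes>\<^bsub>G\<^esub> z = x \<otimes>\<^bsub>G\<^esub> (y \<otimes>\<^bsub>G\<^esub> z)"
    if "x \<in> carrier G" "y \<in> carrier G" "z \<in> carrier G" for x y z
    using that
    by (elim G_cases) (simp add: mult_G shear_mult shear_shear shear_closed H.m_assoc add.assoc)
  show "\<one>\<^bsub>G\<^esub> \<in> carrier G" by (simp add: one_G mem_G shear_0_mem)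
  show "\<one>\<^bsub>G\<^esub> \<otimes>\<^bsub>G\<^esub> x = x" if "x \<in> carrier G" for x
    using that by (elim G_cases) (simp add: one_G mult_G shear_0)
  have "shear a \<one>\<^bsub>H\<^esub> = \<one>\<^bsub>H\<^esub>" for a
    using shear_apply[OF H.one_closed] by (simp add: one_H)
  then show "x \<otimes>\<^bsub>G\<^esub> \<one>\<^bsub>G\<^esub> = x" if "x \<in> carrier G" for x
    using that by (elim G_cases) (simp add: one_G mult_G)
qed

definition x where "x i = (\<lambda>j. if j = i then (1, 0) else (0, 0))" for i :: nat
definition y where "y i = (\<lambda>j. if j = i then (0, 1) else (0, 0))" for i :: nat

lemma x_closed: "x i \<in> carrier H" and y_closed: "y i \<in> carrier H"
  using p_gt_1 by (auto simp: mem_H x_def y_def)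

definition xG where "xG i = (shear 0, x i)"
definition yG where "yG i = (shear 0, y i)"
definition sG where "sG = (shear 1, \<one>\<^bsub>H\<^esub>)"

lemma xG_closed: "xG i \<in> carrier G" and yG_closed: "yG i \<in> carrier G" and sG_closed: "sG \<in> carrier G"
  using x_closed y_closed group.is_monoid[OF group_H] shear_0_mem shear_1_mem
  by (auto simp: xG_def yG_def sG_def mem_G)

lemma s_x_commute: "sG \<otimes>\<^bsub>G\<^esub> xG i = xG i \<otimes>\<^bsub>G\<^esub> sG"
proof -
  interpret H: group H by (rule group_H)
  have "shear 1 (x i) = x i"
    unfolding shear_apply[OF x_closed] using p_gt_1 by (auto simp: x_def)
  then show ?thesis by (simp add: sG_def xG_def mult_G shear_0 x_closed)
qed

lemma s_y_commutator: "sG \<otimes>\<^bsub>G\<^esub> yG i = (xG i \<otimes>\<^bsub>G\<^esub> yG i) \<otimes>\<^bsub>G\<^esub> sG"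
proof -
  interpret H: group H by (rule group_H)
  have "shear 1 (y i) = x i \<otimes>\<^bsub>H\<^esub> y i"
    unfolding shear_apply[OF y_closed] using p_gt_1 by (auto simp: x_def y_def mult_H)
  then show ?thesis
    by (simp add: sG_def xG_def yG_def mult_G shear_0 x_closed y_closed)
qed

section \<open>The kernel of restriction\<close>

abbreviation K where "K \<equiv> residue_ring (int p)"

sublocale bar_complex_hom G K H "H_inclusion p"
proof -
  interpret H: group H by (rule group_H)
  interpret K: cring K by (rule residues.cring[OF residues_p])
  interpret G: monoid G by (rule monoid_G)
  interpret GK: bar_complex G K by unfold_locales
  interpret HK: bar_complex H K by unfold_locales
  show "bar_complex_hom G K H (H_inclusion p)"
  proof
    show "H_inclusion p \<in> hom H G"
      by (auto simp: hom_def H_inclusion_def one_sigma mem_G shear_0_mem mult_G shear_0)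
  qed
qed

lemma carrier_K: "carrier K = {0..<int p}"
  by (auto simp: residue_ring_def)

lemma add_K: "a \<oplus>\<^bsub>K\<^esub> b = (a + b) mod int p"
  by (simp add: residue_ring_def)

lemma zero_K: "\<zero>\<^bsub>K\<^esub> = 0"
  by (simp add: residue_ring_def)

lemma minus_K: "a \<ominus>\<^bsub>K\<^esub> b = (a - b) mod int p"
  by (simp add: a_minus_def add_K residues.res_neg_eq[OF residues_p] mod_simps)

text \<open>
  A \<open>1\<close>-cocycle is a homomorphism to an abelian group, and \<open>x\<^sub>i\<close> is the commutator of \<open>\<sigma>\<close> and \<open>y\<^sub>i\<close>.
\<close>

lemma cocycle_1_xG:
  assumes "f \<in> carrier (cocycle_group G K 1)"
  shows "f [xG i] = \<zero>\<^bsub>K\<^esub>"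
proof -
  have k: "f [g] \<in> carrier K" if "g \<in> carrier G" for g
    using assms G.cochain_closed[of f 1 "[g]"] that by (simp add: G.mem_cocycle tuples_def)
  note c = xG_closed[of i] yG_closed[of i] sG_closed
  have "f [sG] \<oplus>\<^bsub>K\<^esub> f [yG i] = f [xG i] \<oplus>\<^bsub>K\<^esub> f [yG i] \<oplus>\<^bsub>K\<^esub> f [sG]"
    using s_y_commutator[of i] c G.cocycle_1_hom[OF assms]
    by (metis G.G.m_closed)
  then have "f [sG] \<oplus>\<^bsub>K\<^esub> f [yG i] = f [xG i] \<oplus>\<^bsub>K\<^esub> (f [sG] \<oplus>\<^bsub>K\<^esub> f [yG i])"
    using k c by (simp add: G.K.a_assoc G.K.a_comm[of "f [sG]"])
  then show ?thesis
    using k c by (metis G.K.a_closed G.K.add.r_cancel_one)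
qed

text \<open>
  The exponent \<open>a\<close> of \<open>\<sigma>\<^sup>a\<close> is read off from \<open>\<sigma>\<^sup>a(y) = a x + y\<close>.
\<close>

definition exponent where "exponent q = fst (q (y 0) 0)"

lemma exponent_shear: "exponent (shear a) = a mod int p"
  by (simp add: exponent_def shear_apply[OF y_closed]) (simp add: y_def)

lemma massey_form_mod:
  "(2 * (a mod q) * (u mod q) + (a mod q) ^ 2 * (v mod q)) mod q = (2 * a * u + a ^ 2 * v) mod q"
  for a u v q :: int
  unfolding cong_def[symmetric] by (intro cong_add cong_mult cong_pow) (simp_all add: cong_def)

text \<open>
  On \<open>G\<close> let \<open>a\<close> be the exponent of \<open>\<sigma>\<close>, and \<open>\<alpha>\<close>, \<open>\<beta>\<close> the coordinates with respect to \<open>x\<^sub>j\<close>, \<open>y\<^sub>j\<close>. As cochains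
  these satisfy \<open>d a = d \<beta> = 0\<close>, \<open>d \<alpha> = - a \<union> \<beta>\<close> and \<open>d (a\<^sup>2) = - 2 a \<union> a\<close>, so that
  \<open>d (2 a \<union> \<alpha>) = 2 a \<union> a \<union> \<beta> = - d (a\<^sup>2 \<union> \<beta>)\<close>. The cocycle \<open>2 a \<union> \<alpha> + a\<^sup>2 \<union> \<beta>\<close> that results
  represents, for odd \<open>p\<close> and up to a scalar factor, the Massey product of \<open>a\<close>, \<open>a\<close>, \<open>\<beta>\<close>.
\<close>

definition massey where
  "massey j = (\<lambda>gs\<in>tuples G 2.
    (2 * exponent (fst (gs ! 0)) * fst (snd (gs ! 1) j)
      + exponent (fst (gs ! 0)) ^ 2 * snd (snd (gs ! 1) j)) mod int p)"

lemma massey_apply: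
  assumes "(shear a, h) \<in> carrier G" "(shear b, k) \<in> carrier G"
  shows "massey j [(shear a, h), (shear b, k)] = (2 * a * fst (k j) + a ^ 2 * snd (k j)) mod int p"
proof -
  have "[(shear a, h), (shear b, k)] \<in> tuples G 2" using assms by simp
  then show ?thesis
    using massey_form_mod[of a "int p" "fst (k j)" "snd (k j)"] assms
    by (simp add: massey_def exponent_shear mem_G reduced)
qed

lemma massey_cocycle: "massey j \<in> carrier (cocycle_group G K 2)"
proof (rule G.cocycleI)
  show mc: "massey j \<in> carrier (cochain_group G K 2)"
    using p_gt_1 by (auto simp: G.mem_cochain massey_def carrier_K)
  fix gs assume "gs \<in> tuples G (Suc 2)"
  then obtain g1 g2 g3 where gs: "gs = [g1, g2, g3]"
    and g: "g1 \<in> carrier G" "g2 \<in> carrier G" "g3 \<in> carrier G"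
    by (auto simp: tuples_def length_Suc_conv numeral_2_eq_2)
  obtain a1 h1 where 1: "g1 = (shear a1, h1)" "h1 \<in> carrier H" using g by (auto elim: G_cases)
  obtain a2 h2 where 2: "g2 = (shear a2, h2)" "h2 \<in> carrier H" using g by (auto elim: G_cases)
  obtain a3 h3 where 3: "g3 = (shear a3, h3)" "h3 \<in> carrier H" using g by (auto elim: G_cases)
  have 12: "(shear (a1 + a2), h1 \<otimes>\<^bsub>H\<^esub> shear a1 h2) \<in> carrier G"
    using G.G.m_closed[OF g(1,2)] by (simp add: 1 2 mult_G)
  have 23: "(shear (a2 + a3), h2 \<otimes>\<^bsub>H\<^esub> shear a2 h3) \<in> carrier G"
    using G.G.m_closed[OF g(2,3)] by (simp add: 2 3 mult_G)
  \<comment> \<open>The coordinates of the product of the last two elements occur reduced modulo \<open>p\<close> inside a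
    product, so this summand is put into polynomial form before the four are compared.\<close>
  have third: "(2 * a1 * ((fst (h2 j) + (fst (h3 j) + a2 * snd (h3 j)) mod int p) mod int p)
      + a1 ^ 2 * ((snd (h2 j) + snd (h3 j)) mod int p)) mod int p =
    (2 * a1 * (fst (h2 j) + (fst (h3 j) + a2 * snd (h3 j))) + a1 ^ 2 * (snd (h2 j) + snd (h3 j))) mod int p"
    unfolding cong_def[symmetric]
    by (intro cong_add cong_mult cong_refl) (simp_all add: cong_def mod_simps)
  show "coboundary_map G K 2 (massey j) gs = \<zero>\<^bsub>K\<^esub>"
    unfolding gs G.coboundary_2[OF mc g]
    unfolding 1 2 3 mult_G
      massey_apply[OF g(1,2)[unfolded 1 2]] massey_apply[OF g(2,3)[unfolded 2 3]]
      massey_apply[OF 12 g(3)[unfolded 3]] massey_apply[OF g(1)[unfolded 1] 23]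
    unfolding mult_H shear_apply[OF 3(2)] fst_conv snd_conv third
    unfolding add_K minus_K zero_K mod_simps
    by (simp add: power2_eq_square algebra_simps)
qed

text \<open>
  The exponent \<open>a\<close> vanishes on \<open>H\<close>, and it divides both terms of the cocycle.
\<close>

lemma pullback_massey: "pullback 2 (massey j) \<in> coboundaries H K 2"
proof -
  have "pullback 2 (massey j) = \<one>\<^bsub>cochain_group H K 2\<^esub>"
    unfolding pullback_def H.one_cochain
  proof (rule restrict_ext)
    fix hs assume hs: "hs \<in> tuples H 2"
    then obtain h k where "hs = [h, k]" "h \<in> carrier H" "k \<in> carrier H"
      by (auto simp: tuples_def length_Suc_conv numeral_2_eq_2)
    then show "massey j (map (H_inclusion p) hs) = \<zero>\<^bsub>K\<^esub>"
      by (simp add: H_inclusion_def one_sigma massey_apply mem_G shear_0_mem zero_K)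
  qed
  then show ?thesis using subgroup.one_closed[OF H.subgroup_coboundaries] by simp
qed

text \<open>
  Against \<open>\<sigma>\<close>, the class number \<open>j\<close> detects \<open>x\<^sub>j\<close> and no other \<open>x\<^sub>i\<close>. The value \<open>2\<close> is nonzero modulo \<open>p\<close>
  exactly when \<open>p\<close> exceeds \<open>2\<close>.
\<close>

lemma commutator_massey:
  "G.commutator sG (xG i) (cohomology_class G K 2 (massey j)) = (if i = j then 2 mod int p else 0)"
proof -
  have "massey j [sG, xG i] = (if i = j then 2 mod int p else 0)" "massey j [xG i, sG] = 0"
    using massey_apply[OF sG_closed[unfolded sG_def] xG_closed[unfolded xG_def], of j i]
      massey_apply[OF xG_closed[unfolded xG_def] sG_closed[unfolded sG_def], of j i]
    by (auto simp: sG_def xG_def x_def)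
  then show ?thesis
    by (simp add: G.commutator_class[OF sG_closed xG_closed s_x_commute massey_cocycle] minus_K)
qed

theorem kernel_not_finitely_generated:
  assumes "2 < p"
  shows "\<not> finitely_generated_ideal (cohomology_ring G K)
    (a_kernel (cohomology_ring G K) (cohomology_ring H K) (cohomology_map H G K (H_inclusion p)))"
    (is "\<not> finitely_generated_ideal _ ?I")
proof -
  define e where "e j = (\<lambda>m. if m = 2 then cohomology_class G K 2 (massey j) else coboundaries G K m)"
    for j
  show ?thesis
  proof (rule G.not_finitely_generated_by_commutators[of sG xG _ e])
    show "finite (carrier K)" by (simp add: carrier_K)
    show "?I \<subseteq> carrier G.R" by (auto simp: mem_kernel_cohomology_map)
    show "e j \<in> ?I" for j
      unfolding e_def by (rule class_in_kernel[OF massey_cocycle pullback_massey])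
    show "inj (\<lambda>j i. G.commutator sG (xG i) (e j 2))"
    proof (rule injI)
      fix j j'
      assume "(\<lambda>i. G.commutator sG (xG i) (e j 2)) = (\<lambda>i. G.commutator sG (xG i) (e j' 2))"
      from fun_cong[OF this, of j] show "j = j'"
        using assms by (simp add: e_def commutator_massey split: if_splits)
    qed
  qed (simp_all add: sG_closed xG_closed s_x_commute cocycle_1_xG aug_kernel_cohomology_map)
qed

end

theorem proposition4p1:
  fixes p :: nat
  assumes "prime p" and "odd p"
  defines "k \<equiv> residue_ring (int p)"
  defines "G \<equiv> G_group p" and "H \<equiv> H_group p"
  defines "res \<equiv> cohomology_map H G k (H_inclusion p)"
  shows "\<not> finitely_generated_ideal (cohomology_ring G k)
           (a_kernel (cohomology_ring G k) (cohomology_ring H k) res)"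
proof -
  have "2 < p" using assms(1,2) prime_ge_2_nat[of p] by (cases "p = 2") auto
  then interpret shear_group p by unfold_locales simp
  show ?thesis
    unfolding k_def G_def H_def res_def by (rule kernel_not_finitely_generated) fact
qed

end
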